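(* Let $F_0$ be a field of characteristic $2$, and let $F=F_0((d^{-1}))((c^{-1}))((b^{-1}))((a^{-1}))$ be the field of iterated Laurent series in the indeterminates $d^{-1},c^{-1},b^{-1},a^{-1}$. Consider the quaternion algebra $Q=[a,d)$ over $F$. Then the $7$-dimensional quadratic form \[\varphi_2=d[1,a+c]\perp c[1,a+b]\perp bcd[1,a]\perp\langle 1\rangle\] over $F$ is $F_Q$-minimal.
   Context: Let $F$ be a field of characteristic $2$. Quaternion algebras: for $\alpha\in F$, $\beta\in F^\times$, $[\alpha,\beta)$ is the quaternion $F$-algebra generated by $i,j$ with $i^2-i=\alpha$, $j^2=\beta$, $jij^{-1}=i-1$. Quadratic forms: $[1,\alpha]$ denotes the binary form $x^2+xy+\alpha y^2$; for $\lambda\in F^\times$, $\lambda[1,\alpha]$ is the form multiplied by the scalar $\lambda$; $\langle\lambda\rangle$ denotes the one-dimensional form $\lambda x^2$; $\perp$ is orthogonal sum. A subform of a quadratic form is its restriction to a linear subspace, and it is strict if the subspace is proper. Function field: for a quaternion division algebra $Q=[\alpha,\beta)$, $F_Q$ denotes the function field of its Severi-Brauer variety, which is the projective conic $x^2+xy+\alpha y^2+\beta z^2=0$ (defined by a codimension $1$ subform of the norm form $[1,\alpha]\perp\beta[1,\alpha]$ of $Q$). Minimality: a quadratic form $\varphi$ over $F$ is $F_Q$-minimal if $\varphi$ is anisotropic, $\varphi_{F_Q}$ is isotropic, and $\varphi$ does not contain any strict subform which becomes isotropic over $F_Q$. *)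

theory Defs
  imports
    "HOL-Algebra.QuotRing"
    "HOL-Algebra.Algebraic_Closure_Type"
    "HOL-Computational_Algebra.Computational_Algebra"
    "HOL-Library.Product_Plus"
begin

section \<open>Quadratic forms\<close>

text \<open>
  \<open>QForm n c\<close> is the form \<open>\<Sum>i\<le>j<n. c i j * x\<^sub>i * x\<^sub>j\<close> in \<open>n\<close> variables.  Coefficients with
  \<open>i > j\<close> or \<open>j \<ge> n\<close> are irrelevant.
\<close>

datatype 'a qform = QForm (qdim: nat) (qcoeff: "nat \<Rightarrow> nat \<Rightarrow> 'a")

definition binary_qf :: "'f \<Rightarrow> 'f::field qform" where  \<comment> \<open>\<open>[1,\<alpha>]\<close>, i.e. \<open>x\<^sup>2 + x y + \<alpha> y\<^sup>2\<close>\<close>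
  "binary_qf \<alpha> = QForm 2 (\<lambda>i j. if i = 1 \<and> j = 1 then \<alpha> else 1)"

definition unary_qf :: "'f \<Rightarrow> 'f::field qform" where  \<comment> \<open>\<open>\<langle>\<lambda>\<rangle>\<close>\<close>
  "unary_qf l = QForm 1 (\<lambda>i j. l)"

definition scale_qf :: "'f \<Rightarrow> 'f qform \<Rightarrow> 'f::field qform" where
  "scale_qf l \<phi> = QForm (qdim \<phi>) (\<lambda>i j. l * qcoeff \<phi> i j)"

definition orth_sum :: "'f qform \<Rightarrow> 'f qform \<Rightarrow> 'f::field qform" (infixr \<open>\<perp>\<close> 65) where
  "\<phi> \<perp> \<psi> = (let n = qdim \<phi> in
     QForm (n + qdim \<psi>)
       (\<lambda>i j. if i < n \<and> j < n then qcoeff \<phi> i j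
              else if n \<le> i \<and> n \<le> j then qcoeff \<psi> (i - n) (j - n)
              else 0))"

definition qf_eval :: "('r, 'm) ring_scheme \<Rightarrow> 'r qform \<Rightarrow> (nat \<Rightarrow> 'r) \<Rightarrow> 'r" where
  "qf_eval R \<phi> v =
     (\<Oplus>\<^bsub>R\<^esub>j\<in>{..<qdim \<phi>}. \<Oplus>\<^bsub>R\<^esub>i\<in>{..j}. qcoeff \<phi> i j \<otimes>\<^bsub>R\<^esub> (v i \<otimes>\<^bsub>R\<^esub> v j))"

definition isotropic :: "('r, 'm) ring_scheme \<Rightarrow> 'r qform \<Rightarrow> bool" where
  "isotropic R \<phi> \<longleftrightarrow>
     (\<exists>v \<in> {..<qdim \<phi>} \<rightarrow> carrier R.
        (\<exists>i<qdim \<phi>. v i \<noteq> \<zero>\<^bsub>R\<^esub>) \<and> qf_eval R \<phi> v = \<zero>\<^bsub>R\<^esub>)"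

text \<open>
  \<open>ring_of_type_algebra\<close> is the ground field, given by its type, as a ring record.
\<close>

definition anisotropic :: "'f::field qform \<Rightarrow> bool" where
  "anisotropic \<phi> \<longleftrightarrow> \<not> isotropic ring_of_type_algebra \<phi>"

definition base_change :: "('f \<Rightarrow> 'r) \<Rightarrow> 'f qform \<Rightarrow> 'r qform" where
  "base_change h \<phi> = QForm (qdim \<phi>) (\<lambda>i j. h (qcoeff \<phi> i j))"

text \<open>
  \<open>\<psi>\<close> is a subform of \<open>\<phi>\<close> if it is the restriction of \<open>\<phi>\<close> to a linear subspace, expressed in
  coordinates with respect to some basis \<open>w 0, \<dots>, w (qdim \<psi> - 1)\<close> of that subspace.  The
  subspace is proper iff \<open>qdim \<psi> < qdim \<phi>\<close>.
\<close>

definition subform :: "'f::field qform \<Rightarrow> 'f qform \<Rightarrow> bool" where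
  "subform \<psi> \<phi> \<longleftrightarrow>
     (\<exists>w :: nat \<Rightarrow> nat \<Rightarrow> 'f.
        (\<forall>t. (\<forall>k<qdim \<phi>. (\<Sum>i<qdim \<psi>. t i * w i k) = 0) \<longrightarrow> (\<forall>i<qdim \<psi>. t i = 0)) \<and>
        (\<forall>t. qf_eval ring_of_type_algebra \<psi> t =
             qf_eval ring_of_type_algebra \<phi> (\<lambda>k. \<Sum>i<qdim \<psi>. t i * w i k)))"

definition strict_subform :: "'f::field qform \<Rightarrow> 'f qform \<Rightarrow> bool" where
  "strict_subform \<psi> \<phi> \<longleftrightarrow> subform \<psi> \<phi> \<and> qdim \<psi> < qdim \<phi>"


section \<open>Quaternion algebras in characteristic 2\<close>

text \<open>
  An element \<open>(u, v)\<close> of \<open>[\<alpha>,\<beta>)\<close> stands for \<open>u + v j\<close>, where \<open>u\<close> and \<open>v\<close> are in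
  \<open>L = F[i]\<close>, and \<open>(x, y)\<close> in \<open>L\<close> stands for \<open>x + y i\<close>, with \<open>i\<^sup>2 = i + \<alpha>\<close>.  Conjugation by
  \<open>j\<close> is the automorphism \<open>\<sigma>\<close> of \<open>L\<close> with \<open>\<sigma> i = i - 1\<close>, so that
  \<open>(u + v j) (u' + v' j) = (u u' + \<beta> v \<sigma>(v')) + (u v' + v \<sigma>(u')) j\<close>.
\<close>

type_synonym 'f quat = "('f \<times> 'f) \<times> ('f \<times> 'f)"

fun quad_mult :: "'f::field \<Rightarrow> 'f \<times> 'f \<Rightarrow> 'f \<times> 'f \<Rightarrow> 'f \<times> 'f" where
  "quad_mult \<alpha> (x, y) (x', y') = (x * x' + \<alpha> * (y * y'), x * y' + y * x' + y * y')"

fun quad_conj :: "'f \<times> 'f \<Rightarrow> 'f::field \<times> 'f" where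
  "quad_conj (x, y) = (x - y, y)"

fun quad_scale :: "'f \<Rightarrow> 'f \<times> 'f \<Rightarrow> 'f::field \<times> 'f" where
  "quad_scale l (x, y) = (l * x, l * y)"

fun quat_mult :: "'f::field \<Rightarrow> 'f \<Rightarrow> 'f quat \<Rightarrow> 'f quat \<Rightarrow> 'f quat" where
  "quat_mult \<alpha> \<beta> (u, v) (u', v') =
     (quad_mult \<alpha> u u' + quad_scale \<beta> (quad_mult \<alpha> v (quad_conj v')),
      quad_mult \<alpha> u v' + quad_mult \<alpha> v (quad_conj u'))"

definition quaternion_algebra :: "'f::field \<Rightarrow> 'f \<Rightarrow> 'f quat ring" where
  "quaternion_algebra \<alpha> \<beta> =
     \<lparr>carrier = UNIV, monoid.mult = quat_mult \<alpha> \<beta>, one = ((1, 0), (0, 0)), ring.zero = 0, add = (+)\<rparr>"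

abbreviation quat_i :: "'f::field quat" where "quat_i \<equiv> ((0, 1), (0, 0))"
abbreviation quat_j :: "'f::field quat" where "quat_j \<equiv> ((0, 0), (1, 0))"

lemma quat_i_square: "quat_mult \<alpha> \<beta> quat_i quat_i - quat_i = ((\<alpha>, 0), (0, 0))"
  and quat_j_square: "quat_mult \<alpha> \<beta> quat_j quat_j = ((\<beta>, 0), (0, 0))"
  and quat_j_i: "quat_mult \<alpha> \<beta> quat_j quat_i =
                 quat_mult \<alpha> \<beta> (quat_i - ((1, 0), (0, 0))) quat_j"
  by (simp_all add: zero_prod_def)

lemma quaternion_algebra_ring:
  fixes \<alpha> \<beta> :: "'f::field"
  assumes "CHAR('f) = 2"
  shows "ring (quaternion_algebra \<alpha> \<beta>)"
proof -
  have two: "(2::'f) = 0"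
    using of_nat_CHAR[where ?'a = 'f] assms by simp
  have minus: "x - y = x + y" for x y :: 'f
    using two by (metis add_diff_cancel_right diff_add_cancel mult_2 mult_zero_left)
  have dbl: "x + x = 0" "x + (x + y) = y" for x y :: 'f
    using two by (metis mult_2 mult_zero_left, metis add.assoc add_0 mult_2 mult_zero_left)
  have inv: "\<exists>q'. q + q' = (0 :: 'f quat)" for q
    by (rule exI[of _ "- q"]) simp
  show ?thesis
  proof (rule ringI)
    show "abelian_group (quaternion_algebra \<alpha> \<beta>)"
      by (rule abelian_groupI) (simp_all add: quaternion_algebra_def add_ac inv del: split_paired_Ex)
    show "monoid (quaternion_algebra \<alpha> \<beta>)"
      by (rule monoidI)
        (auto simp: quaternion_algebra_def zero_prod_def minus algebra_simps dbl)
  qed (auto simp: quaternion_algebra_def minus algebra_simps dbl)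
qed

lemma quaternion_algebra_inject:
  "quaternion_algebra \<alpha> \<beta> = quaternion_algebra \<alpha>' \<beta>' \<longleftrightarrow> \<alpha> = \<alpha>' \<and> \<beta> = \<beta>'"
proof
  assume "quaternion_algebra \<alpha> \<beta> = quaternion_algebra \<alpha>' \<beta>'"
  then have "quat_mult \<alpha> \<beta> = quat_mult \<alpha>' \<beta>'"
    by (simp add: quaternion_algebra_def)
  then have "quat_mult \<alpha> \<beta> quat_i quat_i = quat_mult \<alpha>' \<beta>' quat_i quat_i"
    and "quat_mult \<alpha> \<beta> quat_j quat_j = quat_mult \<alpha>' \<beta>' quat_j quat_j"
    by simp_all
  then show "\<alpha> = \<alpha>' \<and> \<beta> = \<beta>'"
    by (simp add: zero_prod_def)
qed simp


section \<open>The function field of the Severi--Brauer conic\<close>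

text \<open>
  The homogeneous coordinate ring \<open>F[x,y,z]\<close> of the projective plane is the type
  \<open>'f poly poly poly\<close>, with \<open>x\<close> the outermost and \<open>z\<close> the innermost variable.
\<close>

type_synonym 'f poly3 = "'f poly poly poly"

abbreviation const3 :: "'f::field \<Rightarrow> 'f poly3" where "const3 r \<equiv> [:[:[:r:]:]:]"
abbreviation var_x :: "'f::field poly3" where "var_x \<equiv> [:0, 1:]"
abbreviation var_y :: "'f::field poly3" where "var_y \<equiv> [:[:0, 1:]:]"
abbreviation var_z :: "'f::field poly3" where "var_z \<equiv> [:[:[:0, 1:]:]:]"

definition homogeneous3 :: "nat \<Rightarrow> 'f::field poly3 \<Rightarrow> bool" where
  "homogeneous3 n p \<longleftrightarrow>
     (\<forall>i j k. Polynomial.coeff (Polynomial.coeff (Polynomial.coeff p i) j) k \<noteq> 0 \<longrightarrow> i + j + k = n)"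

definition conic_poly :: "'f::field \<Rightarrow> 'f \<Rightarrow> 'f poly3" where
  "conic_poly \<alpha> \<beta> = var_x ^ 2 + var_x * var_y + const3 \<alpha> * var_y ^ 2 + const3 \<beta> * var_z ^ 2"

text \<open>
  The function field of the projective conic \<open>C\<close> defined by \<open>q = conic_poly \<alpha> \<beta>\<close> consists of the
  quotients \<open>f / g\<close> of homogeneous polynomials of the same degree with \<open>g\<close> not divisible by \<open>q\<close>,
  where \<open>f / g\<close> is identified with \<open>0\<close> iff \<open>q\<close> divides \<open>f\<close>.  In other words, it is the residue
  field of the local ring of the projective plane along \<open>C\<close>.
\<close>

definition conic_local_ring :: "'f::field \<Rightarrow> 'f \<Rightarrow> 'f poly3 fract ring" where
  "conic_local_ring \<alpha> \<beta> =
     \<lparr>carrier = {Fract f g |f g. (\<exists>n. homogeneous3 n f \<and> homogeneous3 n g) \<and>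
                                 \<not> conic_poly \<alpha> \<beta> dvd g},
      monoid.mult = (*), one = 1, ring.zero = 0, add = (+)\<rparr>"

definition conic_ideal :: "'f::field \<Rightarrow> 'f \<Rightarrow> 'f poly3 fract set" where
  "conic_ideal \<alpha> \<beta> =
     {Fract f g |f g. (\<exists>n. homogeneous3 n f \<and> homogeneous3 n g) \<and>
                      \<not> conic_poly \<alpha> \<beta> dvd g \<and> conic_poly \<alpha> \<beta> dvd f}"

definition conic_function_field :: "'f::field \<Rightarrow> 'f \<Rightarrow> 'f poly3 fract set ring" where
  "conic_function_field \<alpha> \<beta> = conic_local_ring \<alpha> \<beta> Quot conic_ideal \<alpha> \<beta>"

definition conic_embed :: "'f::field \<Rightarrow> 'f \<Rightarrow> 'f \<Rightarrow> 'f poly3 fract set" where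
  "conic_embed \<alpha> \<beta> r = conic_ideal \<alpha> \<beta> +>\<^bsub>conic_local_ring \<alpha> \<beta>\<^esub> Fract (const3 r) 1"

text \<open>
  The norm form \<open>[1,\<alpha>] \<perp> \<beta>[1,\<alpha>]\<close> of the quaternion algebra \<open>[\<alpha>,\<beta>)\<close> and its restriction
  to the span of \<open>1, i, j\<close>, which defines the conic; \<open>x + y + y i + z j\<close> is the canonical
  conjugate of \<open>x + y i + z j\<close>.
\<close>

lemma quat_norm_conic:
  fixes \<alpha> \<beta> x y z :: "'f::field"
  assumes "CHAR('f) = 2"
  shows "quat_mult \<alpha> \<beta> ((x, y), (z, 0)) ((x + y, y), (z, 0)) =
           ((x\<^sup>2 + x * y + \<alpha> * y\<^sup>2 + \<beta> * z\<^sup>2, 0), (0, 0))"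
proof -
  have two: "(2::'f) = 0"
    using of_nat_CHAR[where ?'a = 'f] assms by simp
  have dbl: "a + a = 0" "a + (a + b) = b" for a b :: 'f
    using two by (metis mult_2 mult_zero_left, metis add.assoc add_0 mult_2 mult_zero_left)
  show ?thesis
    by (simp add: zero_prod_def algebra_simps power2_eq_square dbl)
qed

definition quat_params :: "'f::field quat ring \<Rightarrow> 'f \<times> 'f" where
  "quat_params Q = (THE p. Q = quaternion_algebra (fst p) (snd p))"

lemma quat_params_quaternion_algebra [simp]:
  "quat_params (quaternion_algebra \<alpha> \<beta>) = (\<alpha>, \<beta>)"
  unfolding quat_params_def
  by (rule the_equality) (auto simp: quaternion_algebra_inject)

definition quat_function_field :: "'f::field quat ring \<Rightarrow> 'f poly3 fract set ring" where
  "quat_function_field Q = (case quat_params Q of (\<alpha>, \<beta>) \<Rightarrow> conic_function_field \<alpha> \<beta>)"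

definition quat_function_field_embed :: "'f::field quat ring \<Rightarrow> 'f \<Rightarrow> 'f poly3 fract set" where
  "quat_function_field_embed Q = (case quat_params Q of (\<alpha>, \<beta>) \<Rightarrow> conic_embed \<alpha> \<beta>)"


section \<open>Minimal forms\<close>

definition isotropic_over_FQ :: "'f::field quat ring \<Rightarrow> 'f qform \<Rightarrow> bool" where
  "isotropic_over_FQ Q \<phi> \<longleftrightarrow>
     isotropic (quat_function_field Q) (base_change (quat_function_field_embed Q) \<phi>)"

definition FQ_minimal :: "'f::field quat ring \<Rightarrow> 'f qform \<Rightarrow> bool" where
  "FQ_minimal Q \<phi> \<longleftrightarrow>
     anisotropic \<phi> \<and> isotropic_over_FQ Q \<phi> \<and>
     (\<nexists>\<psi>. strict_subform \<psi> \<phi> \<and> isotropic_over_FQ Q \<psi>)"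

end

theory Submission
  imports Defs
begin

text \<open>
  On the affine chart \<open>y = 1\<close> put \<open>T = d z\<^sup>2\<close>, so that \<open>x\<^sup>2 + x = a + T\<close> in the function field.
  With \<open>\<rho>\<^sub>j = v\<^sub>2\<^sub>j\<^sub>-\<^sub>1 + x v\<^sub>2\<^sub>j\<close>, \<open>y\<^sub>j = v\<^sub>2\<^sub>j\<close>, the value of the form at \<open>(v\<^sub>1, \<dots>, v\<^sub>7)\<close> is
  \<open>d \<rho>\<^sub>1\<^sup>2 + c d (y\<^sub>1 + z y\<^sub>2)\<^sup>2 + c \<rho>\<^sub>2\<^sup>2 + b c (y\<^sub>2 + d z y\<^sub>3)\<^sup>2 + b c d \<rho>\<^sub>3\<^sup>2 + (v\<^sub>7 + d z y\<^sub>1)\<^sup>2\<close>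
  plus the cross terms \<open>d \<rho>\<^sub>1 y\<^sub>1 + c \<rho>\<^sub>2 y\<^sub>2 + b c d \<rho>\<^sub>3 y\<^sub>3\<close>.  Extend the rank four valuation of the
  iterated Laurent series field to the function field such that \<open>T\<close> becomes slightly larger than \<open>b\<close>.
  Then the six squares have distinct values, and they can only be balanced by cross terms involving
  \<open>y\<^sub>3\<close>.  This forces every isotropic vector to have the same leading terms as a multiple of
  \<open>(x T, T, d x z, d z, x, 1, d\<^sup>2 z\<^sup>3)\<close>, which is itself isotropic.  The values of these seven leading
  terms are distinct modulo the value group of the ground field, so the coordinates of an isotropic
  vector are linearly independent over the ground field, and no isotropic vector comes from a proper subspace.
\<close>

section \<open>Degree functions\<close>

text \<open>
  A degree function is minus a Krull valuation with support \<open>Z\<close>; on \<open>Z\<close>, where the degree should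
  be \<open>-\<infinity>\<close>, the value of \<open>v\<close> is irrelevant.
\<close>

locale degree_function =
  fixes Z :: "'r::comm_ring_1 set" and v :: "'r \<Rightarrow> 'g::linordered_idom"
  assumes zero_mem: "0 \<in> Z"
    and one_notmem: "1 \<notin> Z"
    and add_mem: "\<And>x y. x \<in> Z \<Longrightarrow> y \<in> Z \<Longrightarrow> x + y \<in> Z"
    and mult_mem: "\<And>x y. x \<in> Z \<Longrightarrow> y * x \<in> Z"
    and mult_notmem: "\<And>x y. x \<notin> Z \<Longrightarrow> y \<notin> Z \<Longrightarrow> x * y \<notin> Z"
    and v_mult: "\<And>x y. x \<notin> Z \<Longrightarrow> y \<notin> Z \<Longrightarrow> v (x * y) = v x + v y"
    and v_add: "\<And>x y. x + y \<notin> Z \<Longrightarrow>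
      (x \<notin> Z \<and> v (x + y) \<le> v x) \<or> (y \<notin> Z \<and> v (x + y) \<le> v y)"
begin

text \<open>Elements of \<open>Z\<close> belong to every \<open>below m\<close>, since their degree
  stands for minus infinity.\<close>

definition below :: "'g \<Rightarrow> 'r set" where
  "below m = {x. x \<in> Z \<or> v x < m}"

lemma uminus_mem: "x \<in> Z \<Longrightarrow> - x \<in> Z"
  using mult_mem[of x "-1"] by simp

lemma mult_mem_iff: "x * y \<in> Z \<longleftrightarrow> x \<in> Z \<or> y \<in> Z"
  using mult_mem mult_notmem by (metis mult.commute)

lemma power2_mem_iff: "x\<^sup>2 \<in> Z \<longleftrightarrow> x \<in> Z"
  by (simp add: power2_eq_square mult_mem_iff)

lemma v_one: "v 1 = 0"
  using v_mult[OF one_notmem one_notmem] by simp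

lemma v_power2: "x \<notin> Z \<Longrightarrow> v (x\<^sup>2) = 2 * v x"
  by (simp add: power2_eq_square v_mult)

lemma v_uminus: "v (- x) = v x" if "x \<notin> Z"
proof -
  have m: "- 1 \<notin> Z" using uminus_mem one_notmem by fastforce
  have "v (-1) + v (-1) = 0" using v_mult[OF m m] v_one by simp
  then have "v (-1) = 0" by simp
  then show ?thesis using v_mult[OF m that] by simp
qed

text \<open>In \<open>x = (x + y) + (- y)\<close> the summand \<open>- y\<close> has degree below
  \<open>v x\<close>, so \<open>x + y\<close> must have degree at least \<open>v x\<close>; the
  reverse inequality is \<open>v_add\<close>.\<close>

lemma v_add_below:
  assumes "x \<notin> Z" "y \<in> below (v x)"
  shows "x + y \<notin> Z" "v (x + y) = v x"
proof -
  have minus: "(x + y) + (- y) = x" by simp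
  have le: "(x + y \<notin> Z \<and> v x \<le> v (x + y)) \<or> (- y \<notin> Z \<and> v x \<le> v (- y))"
    using v_add[of "x + y" "- y"] assms(1) by simp
  have "\<not> (- y \<notin> Z \<and> v x \<le> v (- y))"
    using assms(2) v_uminus[of y] uminus_mem[of y] by (cases "y \<in> Z") (auto simp: below_def)
  with le have *: "x + y \<notin> Z" "v x \<le> v (x + y)" by auto
  then show "x + y \<notin> Z" by simp
  have "v (x + y) \<le> v x"
    using v_add[OF *(1)] assms(2) by (auto simp: below_def)
  with * show "v (x + y) = v x" by simp
qed

lemma below_add: "x \<in> below m \<Longrightarrow> y \<in> below m \<Longrightarrow> x + y \<in> below m"
  using v_add[of x y] by (fastforce simp: below_def)

lemma below_sum: "(\<And>i. i \<in> I \<Longrightarrow> f i \<in> below m) \<Longrightarrow> sum f I \<in> below m"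
  by (induction I rule: infinite_finite_induct) (auto simp: below_add, auto simp: below_def zero_mem)

lemma v_sum_unique_max:
  assumes "finite I" "i \<in> I" "f i \<notin> Z" "\<And>j. j \<in> I - {i} \<Longrightarrow> f j \<in> below (v (f i))"
  shows "sum f I \<notin> Z" "v (sum f I) = v (f i)"
proof -
  have "sum f I = f i + sum f (I - {i})"
    using assms by (simp add: sum.remove)
  moreover have "sum f (I - {i}) \<in> below (v (f i))"
    using assms(4) by (rule below_sum)
  ultimately show "sum f I \<notin> Z" "v (sum f I) = v (f i)"
    using v_add_below[OF assms(3)] by simp_all
qed

lemma ex_max:
  assumes "finite I" "\<exists>i\<in>I. f i \<notin> Z"
  obtains i where "i \<in> I" "f i \<notin> Z" "\<And>j. j \<in> I \<Longrightarrow> f j \<notin> Z \<Longrightarrow> v (f j) \<le> v (f i)"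
proof -
  let ?J = "{i \<in> I. f i \<notin> Z}"
  have "finite ?J" "?J \<noteq> {}" using assms by auto
  then obtain i where "i \<in> ?J" "v (f i) = Max ((\<lambda>i. v (f i)) ` ?J)"
    using Max_in[of "(\<lambda>i. v (f i)) ` ?J"] by fastforce
  then show ?thesis using that[of i] \<open>finite ?J\<close> by auto
qed

lemma v_sum_le_max:
  assumes "sum f I \<notin> Z"
  obtains i where "i \<in> I" "f i \<notin> Z" "v (sum f I) \<le> v (f i)"
proof -
  have "\<exists>i\<in>I. f i \<notin> Z \<and> v (sum f I) \<le> v (f i)"
    using assms
  proof (induction I rule: infinite_finite_induct)
    case (insert i I)
    then show ?case using v_add[of "f i" "sum f I"] by (fastforce intro: order_trans)
  qed (use zero_mem in auto)
  then show ?thesis using that by blast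
qed

text \<open>Distinct degrees single out one summand of largest degree, and nothing can cancel
  it.\<close>

lemma v_sum_distinct:
  assumes "finite I" "\<exists>i\<in>I. f i \<notin> Z"
    and dist: "\<And>i j. i \<in> I \<Longrightarrow> j \<in> I \<Longrightarrow> i \<noteq> j \<Longrightarrow> f i \<notin> Z \<Longrightarrow> f j \<notin> Z \<Longrightarrow> v (f i) \<noteq> v (f j)"
  shows "sum f I \<notin> Z" and "\<And>j. j \<in> I \<Longrightarrow> f j \<notin> Z \<Longrightarrow> v (f j) \<le> v (sum f I)"
proof -
  obtain i where i: "i \<in> I" "f i \<notin> Z" "\<And>j. j \<in> I \<Longrightarrow> f j \<notin> Z \<Longrightarrow> v (f j) \<le> v (f i)"
    using ex_max[OF assms(1,2)] by blast
  have "f j \<in> below (v (f i))" if "j \<in> I - {i}" for j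
    using i dist[of j i] that by (fastforce simp: below_def)
  then have "sum f I \<notin> Z \<and> v (sum f I) = v (f i)"
    using v_sum_unique_max[of I i f] assms(1) i by blast
  then show "sum f I \<notin> Z" and "\<And>j. j \<in> I \<Longrightarrow> f j \<notin> Z \<Longrightarrow> v (f j) \<le> v (sum f I)"
    using i by auto
qed

end

lemma degree_function_zeroI:
  fixes v :: "'r::idom \<Rightarrow> 'g::linordered_idom"
  assumes "\<And>x y. x \<noteq> 0 \<Longrightarrow> y \<noteq> 0 \<Longrightarrow> v (x * y) = v x + v y"
    and "\<And>x y. x \<noteq> 0 \<Longrightarrow> y \<noteq> 0 \<Longrightarrow> x + y \<noteq> 0 \<Longrightarrow> v (x + y) \<le> max (v x) (v y)"
  shows "degree_function {0} v"
proof
  fix x y :: 'r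
  assume "x + y \<notin> {0}"
  then show "(x \<notin> {0} \<and> v (x + y) \<le> v x) \<or> (y \<notin> {0} \<and> v (x + y) \<le> v y)"
    using assms(2)[of x y] by (cases "x = 0"; cases "y = 0") (auto simp: le_max_iff_disj)
qed (use assms(1) in auto)


subsection \<open>Laurent series\<close>

text \<open>The lowest exponent carries the leading term, because \<open>g\<close> is the degree of
  the inverse of \<open>fls_X\<close>; hence the minus sign.\<close>

definition fls_degree :: "('a::zero \<Rightarrow> 'g) \<Rightarrow> 'g \<Rightarrow> 'a fls \<Rightarrow> 'g::linordered_idom" where
  "fls_degree v g f = v (fls_nth f (fls_subdegree f)) - of_int (fls_subdegree f) * g"

lemma fls_degree_fls_const: "fls_degree v g (fls_const c) = v c"
  by (simp add: fls_degree_def)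

lemma fls_degree_X_inv: "fls_degree v g (fls_X_inv :: 'a::zero_neq_one fls) = v 1 + g"
  by (simp add: fls_degree_def)

text \<open>The bound \<open>small\<close> makes the new variable infinitely large compared to the coefficient field.\<close>

lemma degree_function_fls:
  fixes v :: "'a::idom \<Rightarrow> 'g::linordered_idom"
  assumes "degree_function {0} v" and small: "\<And>x y. x \<noteq> 0 \<Longrightarrow> y \<noteq> 0 \<Longrightarrow> v x - v y < g"
  shows "degree_function {0} (fls_degree v g)"
proof (rule degree_function_zeroI)
  interpret degree_function "{0}" v by fact
  fix x y :: "'a fls"
  assume nz: "x \<noteq> 0" "y \<noteq> 0"
  show "fls_degree v g (x * y) = fls_degree v g x + fls_degree v g y"
    using nz v_mult by (simp add: fls_degree_def algebra_simps)
  have g: "g > 0" using small[of 1 1] by simp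
  \<comment> \<open>Starting at a higher exponent costs at least \<open>g\<close>, which outweighs
    any difference between the degrees of the leading coefficients.\<close>
  have step: "fls_degree v g z \<le> fls_degree v g x"
    if "x \<noteq> 0" "z \<noteq> 0" "fls_subdegree x < fls_subdegree z" for x z
  proof -
    have "of_int (fls_subdegree x + 1) * g \<le> of_int (fls_subdegree z) * g"
      using that(3) g by (intro mult_right_mono) (auto simp del: of_int_add)
    moreover have "v (fls_nth z (fls_subdegree z)) - v (fls_nth x (fls_subdegree x)) < g"
      using that by (intro small) auto
    ultimately show ?thesis by (simp add: fls_degree_def algebra_simps)
  qed
  assume nz': "x + y \<noteq> 0"
  let ?s = "fls_subdegree"
  consider "?s x < ?s (x + y)" | "?s y < ?s (x + y)" | "?s (x + y) \<le> ?s x" "?s (x + y) \<le> ?s y"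
    by linarith
  then show "fls_degree v g (x + y) \<le> max (fls_degree v g x) (fls_degree v g y)"
  proof cases
    case 1
    then show ?thesis using step[OF nz(1) nz'] by (simp add: le_max_iff_disj)
  next
    case 2
    then show ?thesis using step[OF nz(2) nz'] by (simp add: le_max_iff_disj)
  next
    case 3
    let ?n = "?s (x + y)"
    have ne: "fls_nth x ?n + fls_nth y ?n \<noteq> 0"
      using nz' nth_fls_subdegree_nonzero[of "x + y"] by simp
    have "?s x = ?n" if "fls_nth x ?n \<noteq> 0"
      using that 3 by (metis fls_eq0_below_subdegree linorder_not_less order_le_less)
    moreover have "?s y = ?n" if "fls_nth y ?n \<noteq> 0"
      using that 3 by (metis fls_eq0_below_subdegree linorder_not_less order_le_less)
    moreover have "(fls_nth x ?n \<noteq> 0 \<and> v (fls_nth x ?n + fls_nth y ?n) \<le> v (fls_nth x ?n)) \<or>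
        (fls_nth y ?n \<noteq> 0 \<and> v (fls_nth x ?n + fls_nth y ?n) \<le> v (fls_nth y ?n))"
      using v_add[of "fls_nth x ?n" "fls_nth y ?n"] ne by auto
    ultimately show ?thesis
      by (auto simp: fls_degree_def le_max_iff_disj)
  qed
qed


subsection \<open>Gauss extensions to polynomials\<close>

text \<open>The extension that gives the variable degree \<open>g\<close> and allows no cancellation
  between different monomials.\<close>

definition gauss_degree :: "('a::zero \<Rightarrow> 'g) \<Rightarrow> 'g \<Rightarrow> 'a poly \<Rightarrow> 'g::linordered_idom" where
  "gauss_degree v g p = Max ((\<lambda>k. v (coeff p k) + of_nat k * g) ` {k. coeff p k \<noteq> 0})"

lemma finite_coeff_nz: "finite {k. coeff p k \<noteq> 0}"
  by (rule finite_subset[of _ "{..degree p}"]) (auto simp: le_degree)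

lemma gauss_degree_ge: "coeff p k \<noteq> 0 \<Longrightarrow> v (coeff p k) + of_nat k * g \<le> gauss_degree v g p"
  unfolding gauss_degree_def by (rule Max_ge) (auto simp: finite_coeff_nz)

text \<open>The least index is chosen for the product formula, where it makes one summand of a
  product coefficient strictly dominant.\<close>

lemma gauss_degree_attained:
  assumes "p \<noteq> 0"
  obtains k where "coeff p k \<noteq> 0" "gauss_degree v g p = v (coeff p k) + of_nat k * g"
    "\<And>l. l < k \<Longrightarrow> coeff p l \<noteq> 0 \<Longrightarrow> v (coeff p l) + of_nat l * g < gauss_degree v g p"
proof -
  let ?P = "\<lambda>k. coeff p k \<noteq> 0 \<and> gauss_degree v g p = v (coeff p k) + of_nat k * g"
  have "{k. coeff p k \<noteq> 0} \<noteq> {}"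
    using assms by (auto simp: poly_eq_iff)
  then have "gauss_degree v g p \<in> (\<lambda>k. v (coeff p k) + of_nat k * g) ` {k. coeff p k \<noteq> 0}"
    unfolding gauss_degree_def by (intro Max_in) (auto simp: finite_coeff_nz)
  then have ex: "\<exists>k. ?P k" by auto
  define k where "k = (LEAST k. ?P k)"
  have "?P k" unfolding k_def using ex by (rule LeastI_ex)
  moreover have "\<not> ?P l" if "l < k" for l
    using that unfolding k_def by (rule not_less_Least)
  ultimately show ?thesis
    using that[of k] gauss_degree_ge[of p _ v g] by (metis order_le_less)
qed

lemma gauss_degree_const: "c \<noteq> 0 \<Longrightarrow> gauss_degree v g [:c:] = v c"
  by (rule gauss_degree_attained[of "[:c:]" v g]) (auto simp: coeff_pCons split: nat.splits if_splits)

lemma gauss_degree_var: "gauss_degree v g [:0, 1:] = v (1 :: 'a::zero_neq_one) + g"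
  by (rule gauss_degree_attained[of "[:0, 1:]" v g]) (auto simp: coeff_pCons split: nat.splits if_splits)

text \<open>Gauss's argument: if \<open>i\<close> and \<open>j\<close> are the least indices at
  which \<open>p\<close> and \<open>q\<close> attain their degrees, then
  \<open>coeff p i * coeff q j\<close> dominates coefficient \<open>i + j\<close> of the product.
  The upper bounds for products and sums hold coefficient by coefficient.\<close>

lemma degree_function_gauss:
  fixes v :: "'a::idom \<Rightarrow> 'g::linordered_idom"
  assumes "degree_function {0} v"
  shows "degree_function {0} (gauss_degree v g)"
proof (rule degree_function_zeroI)
  interpret degree_function "{0}" v by fact
  let ?w = "gauss_degree v g"
  fix p q :: "'a poly"
  assume nz: "p \<noteq> 0" "q \<noteq> 0"
  show "?w (p * q) = ?w p + ?w q"
  proof (rule antisym)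
    obtain i where i: "coeff p i \<noteq> 0" "?w p = v (coeff p i) + of_nat i * g"
        "\<And>l. l < i \<Longrightarrow> coeff p l \<noteq> 0 \<Longrightarrow> v (coeff p l) + of_nat l * g < ?w p"
      using gauss_degree_attained[OF nz(1)] by metis
    obtain j where j: "coeff q j \<noteq> 0" "?w q = v (coeff q j) + of_nat j * g"
        "\<And>l. l < j \<Longrightarrow> coeff q l \<noteq> 0 \<Longrightarrow> v (coeff q l) + of_nat l * g < ?w q"
      using gauss_degree_attained[OF nz(2)] by metis
    have lt: "coeff p k * coeff q (i + j - k) \<in> below (v (coeff p i * coeff q j))"
      if "k \<in> {..i + j} - {i}" for k
    proof (cases "coeff p k = 0 \<or> coeff q (i + j - k) = 0")
      case False
      define l where "l = i + j - k"
      have kl: "k + l = i + j" "k \<noteq> i" using that by (auto simp: l_def)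
      have "v (coeff p k) + of_nat k * g \<le> ?w p" "v (coeff q l) + of_nat l * g \<le> ?w q"
        using False by (auto intro!: gauss_degree_ge simp: l_def)
      \<comment> \<open>Since \<open>k + l = i + j\<close> and \<open>k \<noteq> i\<close>, either
        \<open>k < i\<close> or \<open>l < j\<close>, and the minimality of that index gives
        strictness.\<close>
      moreover have "v (coeff p k) + of_nat k * g < ?w p \<or> v (coeff q l) + of_nat l * g < ?w q"
        using i(3)[of k] j(3)[of l] kl False by (cases "k < i") (auto simp: l_def)
      ultimately have "v (coeff p k) + v (coeff q l) + (of_nat k + of_nat l) * g < ?w p + ?w q"
        by (auto simp: algebra_simps)
      also have "\<dots> = v (coeff p i) + v (coeff q j) + (of_nat i + of_nat j) * g"
        using i(2) j(2) by (simp add: algebra_simps)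
      also have "of_nat i + of_nat j = (of_nat k + of_nat l :: 'g)"
        by (metis kl(1) of_nat_add)
      finally show ?thesis
        using False i(1) j(1) by (simp add: below_def v_mult l_def)
    qed (auto simp: below_def)
    have coeff: "coeff (p * q) (i + j) = (\<Sum>k\<le>i + j. coeff p k * coeff q (i + j - k))"
      by (rule coeff_mult)
    have "coeff (p * q) (i + j) \<notin> {0}" "v (coeff (p * q) (i + j)) = v (coeff p i * coeff q j)"
      unfolding coeff
      using v_sum_unique_max[of "{..i + j}" i "\<lambda>k. coeff p k * coeff q (i + j - k)"] lt i(1) j(1)
      by auto
    then have "v (coeff p i) + v (coeff q j) + of_nat (i + j) * g \<le> ?w (p * q)"
      using gauss_degree_ge[of "p * q" "i + j" v g] i(1) j(1) v_mult by simp
    then show "?w p + ?w q \<le> ?w (p * q)"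
      using i(2) j(2) by (simp add: algebra_simps)
  next
    obtain k where k: "coeff (p * q) k \<noteq> 0" "?w (p * q) = v (coeff (p * q) k) + of_nat k * g"
      using gauss_degree_attained[of "p * q"] nz by (metis no_zero_divisors)
    obtain i where i: "i \<le> k" "coeff p i * coeff q (k - i) \<noteq> 0"
        "v (coeff (p * q) k) \<le> v (coeff p i * coeff q (k - i))"
      using v_sum_le_max[of "\<lambda>i. coeff p i * coeff q (k - i)" "{..k}"] k(1)
      by (auto simp: coeff_mult)
    have "v (coeff p i) + of_nat i * g \<le> ?w p" "v (coeff q (k - i)) + of_nat (k - i) * g \<le> ?w q"
      using i(2) by (auto intro!: gauss_degree_ge)
    then show "?w (p * q) \<le> ?w p + ?w q"
      using k(2) i v_mult[of "coeff p i" "coeff q (k - i)"] by (auto simp: algebra_simps of_nat_diff)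
  qed
  assume "p + q \<noteq> 0"
  then obtain k where k: "coeff (p + q) k \<noteq> 0" "?w (p + q) = v (coeff (p + q) k) + of_nat k * g"
    using gauss_degree_attained by metis
  then show "?w (p + q) \<le> max (?w p) (?w q)"
    using v_add[of "coeff p k" "coeff q k"] gauss_degree_ge[of p k v g] gauss_degree_ge[of q k v g]
    by (fastforce simp: le_max_iff_disj)
qed

subsection \<open>Quadratic extensions\<close>

definition quadratic_poly :: "'a::idom \<Rightarrow> 'a poly" where
  "quadratic_poly e = [:e, 1, 1:]"

text \<open>The norm of \<open>A + B x\<close> for a root \<open>x\<close> of
  \<open>quadratic_poly e\<close>: the two roots have sum -1 and product \<open>e\<close>.\<close>

definition norm_form :: "'a::idom \<Rightarrow> 'a \<Rightarrow> 'a \<Rightarrow> 'a" where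
  "norm_form e A B = A * A - A * B + e * (B * B)"

text \<open>\<open>A + B x\<close> is the remainder of \<open>g\<close> modulo the monic polynomial
  \<open>quadratic_poly e\<close>. A relation is used because the coefficients form only an integral
  domain.\<close>

definition reduces_to :: "'a::idom \<Rightarrow> 'a poly \<Rightarrow> 'a \<Rightarrow> 'a \<Rightarrow> bool" where
  "reduces_to e g A B \<longleftrightarrow> quadratic_poly e dvd g - [:A, B:]"

lemma reduces_to_ex: "\<exists>A B. reduces_to e g A B"
proof (induction g)
  case 0
  then show ?case by (intro exI[of _ 0]) (simp add: reduces_to_def)
next
  case (pCons c g)
  then obtain A B h where h: "g - [:A, B:] = quadratic_poly e * h"
    by (auto simp: reduces_to_def dvd_def)
  have "pCons c g - [:c - e * B, A - B:] = quadratic_poly e * ([:0, 1:] * h + [:B:])"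
  proof -
    have "quadratic_poly e * ([:0, 1:] * h + [:B:]) = [:0, 1:] * (g - [:A, B:]) + quadratic_poly e * [:B:]"
      by (simp only: h) (simp add: algebra_simps)
    also have "\<dots> = pCons c g - [:c - e * B, A - B:]"
      by (simp add: quadratic_poly_def algebra_simps)
    finally show ?thesis by simp
  qed
  then show ?case unfolding reduces_to_def dvd_def by blast
qed

lemma reduces_to_linear: "reduces_to e [:A, B:] A B"
  by (simp add: reduces_to_def)

lemma reduces_to_unique:
  assumes "reduces_to e g A B" "reduces_to e g A' B'"
  shows "A = A' \<and> B = B'"
proof -
  have "quadratic_poly e dvd (g - [:A', B':]) - (g - [:A, B:])"
    using assms dvd_diff unfolding reduces_to_def by blast
  then have "quadratic_poly e dvd [:A - A', B - B':]" by simp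
  moreover have "degree (quadratic_poly e) = 2" by (simp add: quadratic_poly_def)
  moreover have "degree [:A - A', B - B':] \<le> 1" by simp
  ultimately have "[:A - A', B - B':] = 0"
    using dvd_imp_degree_le[of "quadratic_poly e" "[:A - A', B - B':]"] by fastforce
  then show ?thesis by simp
qed

lemma reduces_to_add:
  assumes "reduces_to e g A B" "reduces_to e g' A' B'"
  shows "reduces_to e (g + g') (A + A') (B + B')"
proof -
  have "quadratic_poly e dvd (g - [:A, B:]) + (g' - [:A', B':])"
    using assms unfolding reduces_to_def by (rule dvd_add)
  then show ?thesis by (simp add: reduces_to_def algebra_simps)
qed

text \<open>Multiply the remainders and replace the square of the variable by minus the variable
  minus \<open>e\<close>.\<close>

lemma reduces_to_mult:
  assumes "reduces_to e g A B" "reduces_to e g' A' B'"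
  shows "reduces_to e (g * g') (A * A' - e * (B * B')) (A * B' + B * A' - B * B')"
proof -
  have "quadratic_poly e dvd g * (g' - [:A', B':]) + (g - [:A, B:]) * [:A', B':] + quadratic_poly e * [:B * B':]"
    using assms unfolding reduces_to_def by (intro dvd_add dvd_mult dvd_mult2 dvd_triv_left)
  also have "g * (g' - [:A', B':]) + (g - [:A, B:]) * [:A', B':] + quadratic_poly e * [:B * B':]
      = g * g' - [:A * A' - e * (B * B'), A * B' + B * A' - B * B':]"
  proof -
    have "g * (g' - [:A', B':]) + (g - [:A, B:]) * [:A', B':] = g * g' - [:A, B:] * [:A', B':]"
      by (simp only: algebra_simps)
    moreover have "[:A, B:] * [:A', B':] = quadratic_poly e * [:B * B':] +
        [:A * A' - e * (B * B'), A * B' + B * A' - B * B':]"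
      by (simp add: quadratic_poly_def algebra_simps)
    ultimately show ?thesis by simp
  qed
  finally show ?thesis by (simp add: reduces_to_def)
qed

lemma reduces_to_dvd_iff: "reduces_to e g A B \<Longrightarrow> quadratic_poly e dvd g \<longleftrightarrow> A = 0 \<and> B = 0"
  using reduces_to_unique[of e g A B 0 0] by (auto simp: reduces_to_def)

lemma norm_form_mult:
  "norm_form e (A * A' - e * (B * B')) (A * B' + B * A' - B * B') = norm_form e A B * norm_form e A' B'"
  by (simp add: norm_form_def algebra_simps)

text \<open>The degree of the norm is twice the degree extending \<open>v\<close>; the doubling
  avoids halves.\<close>

definition quadratic_degree :: "('a::idom \<Rightarrow> 'g) \<Rightarrow> 'a \<Rightarrow> 'a poly \<Rightarrow> 'g" where
  "quadratic_degree v e g = v (THE n. \<exists>A B. reduces_to e g A B \<and> n = norm_form e A B)"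

lemma quadratic_degree_eq:
  "reduces_to e g A B \<Longrightarrow> quadratic_degree v e g = v (norm_form e A B)"
  unfolding quadratic_degree_def
  by (rule arg_cong[of _ _ v], rule the_equality) (auto dest: reduces_to_unique)

text \<open>
  By \<open>ramified\<close> the degrees of \<open>A\<^sup>2\<close> and \<open>e B\<^sup>2\<close> always differ, so the larger one is the degree of
  the norm of \<open>A + B x\<close>.
\<close>

locale ramified_quadratic = degree_function "{0}" v
  for v :: "'a::idom \<Rightarrow> 'g::linordered_idom" +
  fixes e :: 'a
  assumes e_pos: "e \<noteq> 0" "0 < v e"
    and ramified: "\<And>A B. A \<noteq> 0 \<Longrightarrow> B \<noteq> 0 \<Longrightarrow> 2 * v A \<noteq> v e + 2 * v B"
begin

text \<open>The cross term \<open>A * B\<close> never dominates: its degree is the mean of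
  \<open>2 * v A\<close> and \<open>2 * v B\<close>, and \<open>v e\<close> is positive.\<close>

lemma v_norm_form:
  assumes "A \<noteq> 0 \<or> B \<noteq> 0"
  shows "norm_form e A B \<noteq> 0"
    and "A \<noteq> 0 \<Longrightarrow> 2 * v A \<le> v (norm_form e A B)"
    and "B \<noteq> 0 \<Longrightarrow> v e + 2 * v B \<le> v (norm_form e A B)"
    and "(A \<noteq> 0 \<and> v (norm_form e A B) = 2 * v A) \<or> (B \<noteq> 0 \<and> v (norm_form e A B) = v e + 2 * v B)"
proof -
  have vB: "v (e * (B * B)) = v e + 2 * v B" if "B \<noteq> 0"
    using that e_pos v_mult by simp
  have vA: "v (A * A) = 2 * v A" if "A \<noteq> 0"
    using that v_mult by simp
  have vAB: "v (- (A * B)) = v A + v B" if "A \<noteq> 0" "B \<noteq> 0"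
    using that v_mult v_uminus by simp
  have one: "norm_form e A B \<notin> {0} \<and> v (norm_form e A B) = 2 * v A"
    if A: "A \<noteq> 0" and lt: "B \<noteq> 0 \<Longrightarrow> v e + 2 * v B < 2 * v A"
  proof -
    have "- (A * B) \<in> below (v (A * A))"
    proof (cases "B = 0")
      case False
      then show ?thesis using A lt[OF False] e_pos vA vAB by (simp add: below_def)
    qed (simp add: below_def)
    moreover have "e * (B * B) \<in> below (v (A * A))"
      using lt A vA vB by (cases "B = 0") (auto simp: below_def)
    ultimately have "- (A * B) + e * (B * B) \<in> below (v (A * A))" by (rule below_add)
    with v_add_below[of "A * A"] A
    have "A * A + (- (A * B) + e * (B * B)) \<notin> {0}" "v (A * A + (- (A * B) + e * (B * B))) = v (A * A)"
      by simp_all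
    moreover have "A * A + (- (A * B) + e * (B * B)) = norm_form e A B"
      by (simp add: norm_form_def)
    ultimately show ?thesis using A vA by simp
  qed
  have two: "norm_form e A B \<notin> {0} \<and> v (norm_form e A B) = v e + 2 * v B"
    if B: "B \<noteq> 0" and lt: "A \<noteq> 0 \<Longrightarrow> 2 * v A < v e + 2 * v B"
  proof -
    have "- (A * B) \<in> below (v (e * (B * B)))"
    proof (cases "A = 0")
      case False
      then show ?thesis using B lt[OF False] e_pos vB vAB by (simp add: below_def)
    qed (simp add: below_def)
    moreover have "A * A \<in> below (v (e * (B * B)))"
      using lt B vA vB by (cases "A = 0") (auto simp: below_def)
    ultimately have "A * A + - (A * B) \<in> below (v (e * (B * B)))" using below_add by blast
    with v_add_below[of "e * (B * B)"] B e_pos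
    have "e * (B * B) + (A * A + - (A * B)) \<notin> {0}"
        "v (e * (B * B) + (A * A + - (A * B))) = v (e * (B * B))"
      by simp_all
    moreover have "e * (B * B) + (A * A + - (A * B)) = norm_form e A B"
      by (simp add: norm_form_def)
    ultimately show ?thesis using B vB by simp
  qed
  consider "A \<noteq> 0" "B \<noteq> 0 \<Longrightarrow> v e + 2 * v B < 2 * v A" | "B \<noteq> 0" "A \<noteq> 0 \<Longrightarrow> 2 * v A < v e + 2 * v B"
    using ramified[of A B] assms by (cases "A = 0"; cases "B = 0") (auto simp: neq_iff)
  then have *: "norm_form e A B \<noteq> 0 \<and> (A \<noteq> 0 \<longrightarrow> 2 * v A \<le> v (norm_form e A B)) \<and>
      (B \<noteq> 0 \<longrightarrow> v e + 2 * v B \<le> v (norm_form e A B)) \<and>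
      ((A \<noteq> 0 \<and> v (norm_form e A B) = 2 * v A) \<or> (B \<noteq> 0 \<and> v (norm_form e A B) = v e + 2 * v B))"
  proof cases
    case 1
    show ?thesis using one[OF 1] 1 by (auto simp: less_imp_le)
  next
    case 2
    show ?thesis using two[OF 2] 2 by (auto simp: less_imp_le)
  qed
  show "norm_form e A B \<noteq> 0"
    using * by (rule conjunct1)
  show "2 * v A \<le> v (norm_form e A B)" if "A \<noteq> 0"
    using *[THEN conjunct2, THEN conjunct1] that by (rule mp)
  show "v e + 2 * v B \<le> v (norm_form e A B)" if "B \<noteq> 0"
    using *[THEN conjunct2, THEN conjunct2, THEN conjunct1] that by (rule mp)
  show "(A \<noteq> 0 \<and> v (norm_form e A B) = 2 * v A) \<or> (B \<noteq> 0 \<and> v (norm_form e A B) = v e + 2 * v B)"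
    using *[THEN conjunct2, THEN conjunct2, THEN conjunct2] .
qed

text \<open>Products are handled by multiplicativity of the norm. For sums,
  \<open>v_norm_form\<close> makes the degree the larger of \<open>2 * v A\<close> and
  \<open>v e + 2 * v B\<close>, and each of these satisfies the inequality for sums.\<close>

lemma degree_function_quadratic:
  "degree_function {g. quadratic_poly e dvd g} (quadratic_degree v e)"
proof
  show "1 \<notin> {g. quadratic_poly e dvd g}"
    using reduces_to_dvd_iff[OF reduces_to_linear[of e 1 0]]
    by (metis mem_Collect_eq one_pCons pCons_0_0 zero_neq_one)
next
  fix x y assume xy: "x \<notin> {g. quadratic_poly e dvd g}" "y \<notin> {g. quadratic_poly e dvd g}"
  obtain A B where r1: "reduces_to e x A B"
    using reduces_to_ex by blast
  obtain A' B' where r2: "reduces_to e y A' B'"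
    using reduces_to_ex by blast
  note r = r1 r2
  have nz: "norm_form e A B \<noteq> 0" "norm_form e A' B' \<noteq> 0"
    using xy v_norm_form(1) reduces_to_dvd_iff[OF r1] reduces_to_dvd_iff[OF r2] by blast+
  let ?A = "A * A' - e * (B * B')" and ?B = "A * B' + B * A' - B * B'"
  note rm = reduces_to_mult[OF r]
  have "norm_form e ?A ?B \<noteq> 0" using nz unfolding norm_form_mult by simp
  then have "\<not> (?A = 0 \<and> ?B = 0)" by (auto simp: norm_form_def)
  then show "x * y \<notin> {g. quadratic_poly e dvd g}"
    using reduces_to_dvd_iff[OF rm] by simp
  show "quadratic_degree v e (x * y) = quadratic_degree v e x + quadratic_degree v e y"
    using nz v_mult by (simp add: quadratic_degree_eq[OF rm] quadratic_degree_eq[OF r(1)]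
      quadratic_degree_eq[OF r(2)] norm_form_mult)
next
  fix x y assume xy: "x + y \<notin> {g. quadratic_poly e dvd g}"
  obtain A B where r1: "reduces_to e x A B"
    using reduces_to_ex by blast
  obtain A' B' where r2: "reduces_to e y A' B'"
    using reduces_to_ex by blast
  note r = r1 r2
  note ra = reduces_to_add[OF r]
  have nz: "A + A' \<noteq> 0 \<or> B + B' \<noteq> 0" using xy reduces_to_dvd_iff[OF ra] by auto
  have xi: "x \<notin> {g. quadratic_poly e dvd g} \<longleftrightarrow> A \<noteq> 0 \<or> B \<noteq> 0"
    and yi: "y \<notin> {g. quadratic_poly e dvd g} \<longleftrightarrow> A' \<noteq> 0 \<or> B' \<noteq> 0"
    using reduces_to_dvd_iff[OF r(1)] reduces_to_dvd_iff[OF r(2)] by auto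
  have *: "(s \<noteq> 0 \<and> v (s + s') \<le> v s) \<or> (s' \<noteq> 0 \<and> v (s + s') \<le> v s')" if "s + s' \<noteq> 0" for s s'
    using v_add[of s s'] that by auto
  show "(x \<notin> {g. quadratic_poly e dvd g} \<and> quadratic_degree v e (x + y) \<le> quadratic_degree v e x) \<or>
      (y \<notin> {g. quadratic_poly e dvd g} \<and> quadratic_degree v e (x + y) \<le> quadratic_degree v e y)"
    unfolding quadratic_degree_eq[OF ra] quadratic_degree_eq[OF r(1)] quadratic_degree_eq[OF r(2)] xi yi
    using v_norm_form(4)[OF nz]
  proof
    assume h: "A + A' \<noteq> 0 \<and> v (norm_form e (A + A') (B + B')) = 2 * v (A + A')"
    from *[of A A'] h have "(A \<noteq> 0 \<and> v (A + A') \<le> v A) \<or> (A' \<noteq> 0 \<and> v (A + A') \<le> v A')" by blast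
    then show "(A \<noteq> 0 \<or> B \<noteq> 0) \<and> v (norm_form e (A + A') (B + B')) \<le> v (norm_form e A B) \<or>
        (A' \<noteq> 0 \<or> B' \<noteq> 0) \<and> v (norm_form e (A + A') (B + B')) \<le> v (norm_form e A' B')"
    proof
      assume "A \<noteq> 0 \<and> v (A + A') \<le> v A"
      then show ?thesis using h v_norm_form(2)[of A B] by simp
    next
      assume "A' \<noteq> 0 \<and> v (A + A') \<le> v A'"
      then show ?thesis using h v_norm_form(2)[of A' B'] by simp
    qed
  next
    assume h: "B + B' \<noteq> 0 \<and> v (norm_form e (A + A') (B + B')) = v e + 2 * v (B + B')"
    from *[of B B'] h have "(B \<noteq> 0 \<and> v (B + B') \<le> v B) \<or> (B' \<noteq> 0 \<and> v (B + B') \<le> v B')" by blast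
    then show "(A \<noteq> 0 \<or> B \<noteq> 0) \<and> v (norm_form e (A + A') (B + B')) \<le> v (norm_form e A B) \<or>
        (A' \<noteq> 0 \<or> B' \<noteq> 0) \<and> v (norm_form e (A + A') (B + B')) \<le> v (norm_form e A' B')"
    proof
      assume "B \<noteq> 0 \<and> v (B + B') \<le> v B"
      then show ?thesis using h v_norm_form(3)[of A B] by simp
    next
      assume "B' \<noteq> 0 \<and> v (B + B') \<le> v B'"
      then show ?thesis using h v_norm_form(3)[of A' B'] by simp
    qed
  qed
qed (simp_all add: dvd_add dvd_mult)

end

section \<open>Isotropic vectors over the function field\<close>

text \<open>
  Integer polynomials are ordered by the sign of the leading coefficient, so they serve as the
  lexicographically ordered value group.
\<close>

definition W :: "nat \<Rightarrow> int poly" where "W k = [:0, 1:] ^ k"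

lemma coeff_W: "coeff (W k) n = (if n = k then 1 else 0)"
  by (induction k arbitrary: n) (auto simp: W_def coeff_pCons split: nat.splits)

lemma coeff_numeral_mult: "coeff (numeral n * p) k = numeral n * coeff (p::int poly) k"
  by (simp add: numeral_poly)

lemma coeff_numeral: "coeff (numeral n :: int poly) k = (if k = 0 then numeral n else 0)"
  by (simp add: numeral_poly coeff_pCons split: nat.splits)

lemmas coeff_W_simps = coeff_W coeff_numeral_mult coeff_numeral

text \<open>Each level is infinitely larger than the one before; the factor 16 is large enough for
  the coefficients in the degree comparisons below.\<close>

lemma W_less: "0 < W 1" "16 < W 1" "16 * W 1 < W 2" "16 * W 2 < W 3" "16 * W 3 < W 4"
  by (simp_all add: less_poly_def pos_poly_pCons numeral_poly W_def power_numeral_reduce)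

lemma char_2_double:
  assumes "(2 :: 'r::comm_ring_1) = 0"
  shows "p + p = (0::'r)" "p + (p + r) = (r::'r)"
proof -
  show p: "p + p = 0" for p :: 'r
    using assms by (simp flip: mult_2)
  show "p + (p + r) = r"
    using p by (simp flip: add.assoc)
qed

text \<open>
  Here \<open>x\<close> and \<open>t\<close> are the affine coordinates \<open>x / y\<close> and \<open>z / y\<close> of the conic.  The degree of
  \<open>T = d t\<^sup>2\<close> is chosen between those of \<open>b\<close> and \<open>b c\<close>.  All degrees are doubled, so that \<open>x\<close>
  (of half the degree of \<open>a\<close>) has degree \<open>W 4\<close>.  The condition \<open>v_class\<close> says that \<open>b\<close>, \<open>c\<close>, \<open>d\<close>
  are independent modulo twice the value group.
\<close>

locale conic_degree = degree_function Z v
  for Z :: "'r::comm_ring_1 set" and v :: "'r \<Rightarrow> int poly" +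
  fixes a b c d x t :: 'r
  assumes two: "(2::'r) = 0"
    and conic: "x\<^sup>2 + x + a + d * t\<^sup>2 \<in> Z"
    and notmem: "b \<notin> Z" "c \<notin> Z" "d \<notin> Z" "x \<notin> Z" "t \<notin> Z"
    and v_gens: "v b = 4 * W 3" "v c = 2 * W 2" "v d = 2 * W 1" "v x = W 4" "v t = 2 * W 3 + 2"
    and v_class: "\<And>z. z \<notin> Z \<Longrightarrow> even (coeff (v z) 1) \<and> even (coeff (v z) 2) \<and>
      4 dvd coeff (v z) 3 - coeff (v z) 0"
begin

lemma mult_below:
  assumes "k \<notin> Z" "\<lbrakk>p \<notin> Z; q \<notin> Z\<rbrakk> \<Longrightarrow> v k + v p + v q < m"
  shows "k * p * q \<in> below m"
  using assms by (cases "p \<in> Z \<or> q \<in> Z") (auto simp: below_def mult_mem_iff v_mult)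

lemmas monomial_simps = mult_mem_iff power2_mem_iff notmem v_mult v_power2 v_gens

text \<open>By \<open>v_class\<close> this is unchanged when a doubled degree is added, so it
  separates classes modulo squares.\<close>

definition residue :: "int poly \<Rightarrow> int \<times> int \<times> int" where
  "residue p = (coeff p 1 mod 4, coeff p 2 mod 4, (coeff p 3 - coeff p 0) mod 8)"

lemma residue_square:
  assumes "z \<notin> Z"
  shows "residue (k + 2 * v z) = residue k"
proof -
  obtain i j l where "coeff (v z) 1 = 2 * i" "coeff (v z) 2 = 2 * j" "coeff (v z) 3 - coeff (v z) 0 = 4 * l"
    using v_class[OF assms] by (auto elim!: dvdE)
  then have "coeff (k + 2 * v z) 1 = coeff k 1 + i * 4" "coeff (k + 2 * v z) 2 = coeff k 2 + j * 4"
      "coeff (k + 2 * v z) 3 - coeff (k + 2 * v z) 0 = (coeff k 3 - coeff k 0) + l * 8"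
    by (simp_all add: coeff_W_simps)
  then show ?thesis by (simp add: residue_def del: coeff_add)
qed

text \<open>
  The coefficients of the six squares are independent modulo squares, hence the largest square must be
  balanced by a cross term; the only cross terms that can be that large involve \<open>y\<close>.
\<close>

lemma squares_bound:
  fixes r1 z1 r2 z2 r3 z7 y :: 'r
  defines "K \<equiv> \<lambda>i. [d, c * d, c, b * c, b * c * d, 1] ! i"
    and "z \<equiv> \<lambda>i. [r1, z1, r2, z2, r3, z7] ! i"
  assumes eq: "d * r1\<^sup>2 + c * d * z1\<^sup>2 + c * r2\<^sup>2 + b * c * z2\<^sup>2 + b * c * d * r3\<^sup>2 + z7\<^sup>2 +
      (d * r1 * (z1 + t * z2 + d * t\<^sup>2 * y) + c * r2 * (z2 + d * t * y) + b * c * d * r3 * y) \<in> Z"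
    and i: "i < 6" "z i \<notin> Z"
  shows "y \<notin> Z \<and> v (K i) + 2 * v (z i) \<le> 8 * W 3 + 6 * W 1 + 8 + 2 * v y"
proof (rule ccontr)
  assume neg: "\<not> ?thesis"
  let ?S = "\<lambda>j. K j * (z j)\<^sup>2"
  have less6: "j = 0 \<or> j = 1 \<or> j = 2 \<or> j = 3 \<or> j = 4 \<or> j = 5" if "j < 6" for j :: nat
    using that by linarith
  have K: "K j \<notin> Z" if "j < 6" for j
    using less6[OF that] one_notmem notmem by (auto simp: K_def mult_mem_iff)
  have S_mem: "?S j \<in> Z \<longleftrightarrow> z j \<in> Z" if "j < 6" for j
    using K[OF that] by (simp add: mult_mem_iff power2_mem_iff)
  have v_S: "v (?S j) = v (K j) + 2 * v (z j)" if "j < 6" "z j \<notin> Z" for j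
    using K[OF that(1)] that(2) by (simp add: v_mult v_power2 power2_mem_iff)
  have "residue (v (K j)) = [(2, 0, 0), (2, 2, 0), (0, 2, 0), (0, 2, 4), (2, 2, 4), (0, 0, 0)] ! j"
    if "j < 6" for j
    using less6[OF that] notmem
    by (elim disjE) (simp_all add: K_def residue_def v_mult mult_mem_iff v_gens v_one coeff_W_simps)
  then have res: "residue (v (?S j)) = [(2, 0, 0), (2, 2, 0), (0, 2, 0), (0, 2, 4), (2, 2, 4), (0, 0, 0)] ! j"
    if "j < 6" "z j \<notin> Z" for j
    using that by (simp add: v_S residue_square)
  have dist: "v (?S j) \<noteq> v (?S l)" if jl: "j < 6" "l < 6" "j \<noteq> l" "z j \<notin> Z" "z l \<notin> Z" for j l
  proof
    assume "v (?S j) = v (?S l)"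
    then have "[(2, 0, 0), (2, 2, 0), (0, 2, 0), (0, 2, 4), (2, 2, 4), (0, 0, 0 :: int)] ! j =
        [(2, 0, 0), (2, 2, 0), (0, 2, 0), (0, 2, 4), (2, 2, 4), (0 :: int, 0 :: int, 0)] ! l"
      using res jl by metis
    then show False using less6[OF jl(1)] less6[OF jl(2)] jl(3) by (elim disjE) simp_all
  qed
  have ex: "\<exists>j\<in>{..<6}. ?S j \<notin> Z"
    using i S_mem by auto
  define M where "M = v (sum ?S {..<6})"
  have sum_S: "sum ?S {..<6} \<notin> Z" and le_M: "v (K j) + 2 * v (z j) \<le> M" if "j < 6" "z j \<notin> Z" for j
    using v_sum_distinct[of "{..<6}" ?S] ex dist S_mem v_S that by (auto simp: M_def)
  have "sum ?S {..<6} \<notin> Z" using sum_S i by blast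
  \<comment> \<open>The threshold comes from the cross term
    \<open>d * (d * t\<^sup>2) * r1 * y\<close>: as \<open>d * r1\<^sup>2\<close> has degree at most
    \<open>M\<close>, twice the degree of this term is at most \<open>M\<close> plus the threshold.
    The other cross terms with \<open>y\<close> have smaller constants.\<close>
  have y: "8 * W 3 + 6 * W 1 + 8 + 2 * v y < M" if "y \<notin> Z"
    using le_M[OF i] that neg by linarith
  note bounds = le_M[of 0, unfolded K_def z_def, simplified] le_M[of 1, unfolded K_def z_def, simplified]
    le_M[of 2, unfolded K_def z_def, simplified] le_M[of 3, unfolded K_def z_def, simplified]
    le_M[of 4, unfolded K_def z_def, simplified] le_M[of 5, unfolded K_def z_def, simplified]
  \<comment> \<open>Twice the degree of a term without \<open>y\<close> is compared with the sum of
    the degrees of two squares. For \<open>d * t * r1 * z2\<close> this uses that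
    \<open>d * t\<^sup>2\<close> has smaller degree than \<open>b * c\<close>.\<close>
  have "d * r1 * z1 \<in> below M" "(d * t) * r1 * z2 \<in> below M" "(d * (d * t\<^sup>2)) * r1 * y \<in> below M"
    "c * r2 * z2 \<in> below M" "(c * (d * t)) * r2 * y \<in> below M" "(b * c * d) * r3 * y \<in> below M"
    using bounds y W_less by (auto intro!: mult_below simp: monomial_simps)
  then have "(d * r1 * z1 + (d * t) * r1 * z2 + (d * (d * t\<^sup>2)) * r1 * y) +
      (c * r2 * z2 + (c * (d * t)) * r2 * y) + (b * c * d) * r3 * y \<in> below M"
    by (intro below_add)
  then have "d * r1 * (z1 + t * z2 + d * t\<^sup>2 * y) + c * r2 * (z2 + d * t * y) + b * c * d * r3 * y \<in> below M"
    by (simp add: algebra_simps)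
  from v_add_below(1)[OF \<open>sum ?S {..<6} \<notin> Z\<close>, folded M_def, OF this]
  show False using eq by (simp add: K_def z_def eval_nat_numeral add.assoc)
qed

text \<open>With \<open>y = f 5\<close>, \<open>squares_bound\<close> makes the new coordinates
  small, so that \<open>f 0\<close> to \<open>f 6\<close> have the degrees of the expected leading
  terms times \<open>y\<close>. Factors \<open>l i\<close> of the stated kind keep these seven
  degrees distinct.\<close>

lemma coordinates_independent:
  fixes f l :: "nat \<Rightarrow> 'r"
  assumes iso: "d * ((f 0)\<^sup>2 + f 0 * f 1 + (a + c) * (f 1)\<^sup>2) + c * ((f 2)\<^sup>2 + f 2 * f 3 + (a + b) * (f 3)\<^sup>2) +
      b * c * d * ((f 4)\<^sup>2 + f 4 * f 5 + a * (f 5)\<^sup>2) + (f 6)\<^sup>2 \<in> Z"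
    and nonzero: "\<exists>i<7. f i \<notin> Z"
    and l: "\<And>i. i < 7 \<Longrightarrow> l i \<notin> Z \<Longrightarrow> coeff (v (l i)) 0 = 0 \<and> even (coeff (v (l i)) 4)"
    and sum: "(\<Sum>i<7. l i * f i) \<in> Z"
  shows "\<forall>i<7. l i \<in> Z"
proof (rule ccontr)
  assume neg: "\<not> ?thesis"
  define r1 r2 r3 where "r1 = f 0 + x * f 1" and "r2 = f 2 + x * f 3" and "r3 = f 4 + x * f 5"
  define z1 z2 z7 where "z1 = f 1 + t * f 3" and "z2 = f 3 + d * t * f 5" and "z7 = f 6 + d * t * f 1"
  define y where "y = f 5"
  note dbl = char_2_double[OF two]
  have f: "f 0 = x * f 1 + r1" "f 1 = t * f 3 + z1" "f 2 = x * f 3 + r2" "f 3 = d * t * y + z2"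
      "f 4 = x * y + r3" "f 5 = y" "f 6 = d * t * f 1 + z7"
    by (simp_all add: r1_def r2_def r3_def z1_def z2_def z7_def y_def dbl add_ac)
  \<comment> \<open>Completing the squares changes the value only by a multiple of the conic
    relation.\<close>
  have "d * r1\<^sup>2 + c * d * z1\<^sup>2 + c * r2\<^sup>2 + b * c * z2\<^sup>2 + b * c * d * r3\<^sup>2 + z7\<^sup>2 +
      (d * r1 * f 1 + c * r2 * f 3 + b * c * d * r3 * y) =
    (d * ((f 0)\<^sup>2 + f 0 * f 1 + (a + c) * (f 1)\<^sup>2) + c * ((f 2)\<^sup>2 + f 2 * f 3 + (a + b) * (f 3)\<^sup>2) +
      b * c * d * ((f 4)\<^sup>2 + f 4 * f 5 + a * (f 5)\<^sup>2) + (f 6)\<^sup>2) +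
    (d * (f 1)\<^sup>2 + c * (f 3)\<^sup>2 + b * c * d * (f 5)\<^sup>2) * (x\<^sup>2 + x + a + d * t\<^sup>2)"
    unfolding r1_def r2_def r3_def z1_def z2_def z7_def y_def
    by (simp add: power2_eq_square algebra_simps dbl two)
  also have "\<dots> \<in> Z" using iso conic mult_mem add_mem by blast
  finally have "d * r1\<^sup>2 + c * d * z1\<^sup>2 + c * r2\<^sup>2 + b * c * z2\<^sup>2 + b * c * d * r3\<^sup>2 + z7\<^sup>2 +
      (d * r1 * f 1 + c * r2 * f 3 + b * c * d * r3 * y) \<in> Z" .
  moreover have "f 1 = z1 + t * z2 + d * t\<^sup>2 * y" "f 3 = z2 + d * t * y"
    using f(2,4) by (simp_all add: algebra_simps power2_eq_square)
  ultimately have eq: "d * r1\<^sup>2 + c * d * z1\<^sup>2 + c * r2\<^sup>2 + b * c * z2\<^sup>2 + b * c * d * r3\<^sup>2 + z7\<^sup>2 +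
      (d * r1 * (z1 + t * z2 + d * t\<^sup>2 * y) + c * r2 * (z2 + d * t * y) + b * c * d * r3 * y) \<in> Z"
    by simp
  note sb = squares_bound[OF eq]
  note bounds = sb[of 0, simplified] sb[of 1, simplified] sb[of 2, simplified]
    sb[of 3, simplified] sb[of 4, simplified] sb[of 5, simplified]
  have y: "y \<notin> Z"
  proof
    assume "y \<in> Z"
    then have "r1 \<in> Z" "r2 \<in> Z" "r3 \<in> Z" "z1 \<in> Z" "z2 \<in> Z" "z7 \<in> Z" using bounds by blast+
    with \<open>y \<in> Z\<close> have "f 3 \<in> Z" "f 5 \<in> Z" "f 4 \<in> Z"
      using f(4-6) by (auto intro!: add_mem mult_mem)
    moreover from this have "f 1 \<in> Z" "f 2 \<in> Z"
      using f(2,3) \<open>r2 \<in> Z\<close> \<open>z1 \<in> Z\<close> by (auto intro!: add_mem mult_mem)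
    moreover from this have "f 0 \<in> Z" "f 6 \<in> Z"
      using f(1,7) \<open>r1 \<in> Z\<close> \<open>z7 \<in> Z\<close> by (auto intro!: add_mem mult_mem)
    ultimately have "\<forall>i<7. f i \<in> Z" by (auto simp: eval_nat_numeral less_Suc_eq)
    then show False using nonzero by blast
  qed
  have lead: "p + q \<notin> Z \<and> v (p + q) = m" if "p \<notin> Z" "v p = m" "q \<notin> Z \<Longrightarrow> v q < m" for p q m
    using v_add_below[of p q] that by (auto simp: below_def)
  \<comment> \<open>In each decomposition from \<open>f\<close> the first summand dominates, because
    the second is limited by \<open>bounds\<close>. The order follows the dependencies among the
    coordinates.\<close>
  have v3: "f 3 \<notin> Z \<and> v (f 3) = 2 * W 3 + 2 * W 1 + 2 + v y"
    unfolding f(4) using bounds y W_less notmem by (intro lead) (auto simp: monomial_simps)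
  have v1: "f 1 \<notin> Z \<and> v (f 1) = 4 * W 3 + 2 * W 1 + 4 + v y"
    unfolding f(2) using bounds y v3 W_less notmem by (intro lead) (auto simp: monomial_simps)
  have v6: "f 6 \<notin> Z \<and> v (f 6) = 6 * W 3 + 4 * W 1 + 6 + v y"
    unfolding f(7) using bounds y v1 W_less notmem by (intro lead) (auto simp: monomial_simps v_one)
  have v0: "f 0 \<notin> Z \<and> v (f 0) = W 4 + 4 * W 3 + 2 * W 1 + 4 + v y"
    unfolding f(1) using bounds y v1 W_less notmem by (intro lead) (auto simp: monomial_simps)
  have v2: "f 2 \<notin> Z \<and> v (f 2) = W 4 + 2 * W 3 + 2 * W 1 + 2 + v y"
    unfolding f(3) using bounds y v3 W_less notmem by (intro lead) (auto simp: monomial_simps)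
  have v4: "f 4 \<notin> Z \<and> v (f 4) = W 4 + v y"
    unfolding f(5) using bounds y W_less notmem by (intro lead) (auto simp: monomial_simps)
  have v5: "f 5 \<notin> Z \<and> v (f 5) = v y"
    using f(6) y by simp
  have less7: "j = 0 \<or> j = 1 \<or> j = 2 \<or> j = 3 \<or> j = 4 \<or> j = 5 \<or> j = 6" if "j < 7" for j :: nat
    using that by linarith
  \<comment> \<open>Relative to \<open>v y\<close>, the constant coefficient and the parity of
    coefficient 4 already separate the seven coordinates, and multiplication by \<open>l j\<close>
    changes neither.\<close>
  let ?sig = "\<lambda>p. (coeff (p - v y) 0, coeff (p - v y) 4 mod 2)"
  have f_mem: "f j \<notin> Z" if "j < 7" for j
    using less7[OF that] v0 v1 v2 v3 v4 v5 v6 by auto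
  have vf: "?sig (v (f j)) = [(4, 1), (4, 0), (2, 1), (2, 0), (0, 1), (0, 0), (6, 0)] ! j" if "j < 7" for j
    using less7[OF that] v0 v1 v2 v3 v4 v5 v6 by (elim disjE) (simp_all add: coeff_W_simps)
  have sig: "?sig (v (l j * f j)) = [(4, 1), (4, 0), (2, 1), (2, 0), (0, 1), (0, 0), (6, 0)] ! j"
    if j: "j < 7" "l j \<notin> Z" for j
  proof -
    obtain n where "coeff (v (l j)) 4 = 2 * n" using l[OF j] by blast
    then have "?sig (v (l j * f j)) = ?sig (v (f j))"
      using l[OF j] j f_mem[OF j(1)] by (simp add: v_mult) presburger
    then show ?thesis using vf[OF j(1)] by simp
  qed
  have dist: "v (l j * f j) \<noteq> v (l k * f k)" if jk: "j < 7" "k < 7" "j \<noteq> k" "l j \<notin> Z" "l k \<notin> Z" for j k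
  proof
    assume "v (l j * f j) = v (l k * f k)"
    then have "[(4, 1), (4, 0), (2, 1), (2, 0), (0, 1), (0, 0 :: int), (6 :: int, 0)] ! j =
        [(4, 1), (4, 0), (2, 1), (2, 0), (0, 1), (0, 0 :: int), (6 :: int, 0)] ! k"
      using sig jk by metis
    then show False using less7[OF jk(1)] less7[OF jk(2)] jk(3) by (elim disjE) simp_all
  qed
  have "\<exists>j\<in>{..<7}. l j * f j \<notin> Z"
    using neg f_mem mult_notmem by blast
  then have "(\<Sum>i<7. l i * f i) \<notin> Z"
    using dist mult_mem_iff by (intro v_sum_distinct(1)) auto
  then show False using sum by simp
qed

end

section \<open>Homogeneous polynomials modulo the conic\<close>

lemma homogeneous3_add: "homogeneous3 n f \<Longrightarrow> homogeneous3 n g \<Longrightarrow> homogeneous3 n (f + g)"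
  unfolding homogeneous3_def by (metis add.right_neutral coeff_add)

lemma homogeneous3_0: "homogeneous3 n 0"
  by (simp add: homogeneous3_def)

lemma homogeneous3_sum: "(\<And>i. i \<in> I \<Longrightarrow> homogeneous3 n (f i)) \<Longrightarrow> homogeneous3 n (sum f I)"
  by (induction I rule: infinite_finite_induct) (auto simp: homogeneous3_0 homogeneous3_add)

lemma homogeneous3_uminus: "homogeneous3 n f \<Longrightarrow> homogeneous3 n (- f)"
  by (simp add: homogeneous3_def)

lemma homogeneous3_mult:
  assumes "homogeneous3 m f" "homogeneous3 n g"
  shows "homogeneous3 (m + n) (f * g)"
  unfolding homogeneous3_def
proof (intro allI impI)
  fix i j k
  assume "coeff (coeff (coeff (f * g) i) j) k \<noteq> 0"
  then have "(\<Sum>i'\<le>i. \<Sum>j'\<le>j. \<Sum>k'\<le>k. coeff (coeff (coeff f i') j') k' *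
      coeff (coeff (coeff g (i - i')) (j - j')) (k - k')) \<noteq> 0"
    by (simp add: coeff_mult coeff_sum)
  then obtain i' j' k' where le: "i' \<le> i" "j' \<le> j" "k' \<le> k" and
      "coeff (coeff (coeff f i') j') k' * coeff (coeff (coeff g (i - i')) (j - j')) (k - k') \<noteq> 0"
    by (meson atMost_iff sum.not_neutral_contains_not_neutral)
  then have "i' + j' + k' = m" "(i - i') + (j - j') + (k - k') = n"
    using assms unfolding homogeneous3_def by (metis mult_eq_0_iff)+
  then show "i + j + k = m + n" using le by linarith
qed

lemma homogeneous3_power: "homogeneous3 n f \<Longrightarrow> homogeneous3 (k * n) (f ^ k)"
proof (induction k)
  case 0
  then show ?case by (auto simp: homogeneous3_def one_pCons coeff_pCons split: nat.splits)
next
  case (Suc k)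
  then show ?case using homogeneous3_mult[of n f "k * n" "f ^ k"] by simp
qed

lemma homogeneous3_const: "homogeneous3 0 (const3 r)"
  by (auto simp: homogeneous3_def coeff_pCons split: nat.splits)

lemma homogeneous3_var: "homogeneous3 1 var_x" "homogeneous3 1 var_y" "homogeneous3 1 var_z"
  by (auto simp: homogeneous3_def coeff_pCons one_pCons split: nat.splits if_splits)

text \<open>The chart \<open>y = 1\<close>: as \<open>y\<close> is the middle variable, every
  coefficient in \<open>x\<close> is evaluated at 1, which leaves polynomials in \<open>x\<close>
  over polynomials in \<open>z\<close>.\<close>

definition dehomogenize :: "'f::field poly3 \<Rightarrow> 'f poly poly" where
  "dehomogenize f = map_poly (\<lambda>p. poly p 1) f"

lemma coeff_dehomogenize: "coeff (dehomogenize f) i = poly (coeff f i) 1"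
  by (simp add: dehomogenize_def coeff_map_poly)

lemma dehomogenize_pCons: "dehomogenize (pCons p f) = pCons (poly p 1) (dehomogenize f)"
  by (simp add: poly_eq_iff coeff_dehomogenize coeff_pCons split: nat.splits)

lemma dehomogenize_0: "dehomogenize 0 = 0"
  by (simp add: dehomogenize_def)

lemma dehomogenize_add: "dehomogenize (f + g) = dehomogenize f + dehomogenize g"
  by (simp add: poly_eq_iff coeff_dehomogenize)

lemma dehomogenize_diff: "dehomogenize (f - g) = dehomogenize f - dehomogenize g"
  by (simp add: poly_eq_iff coeff_dehomogenize)

lemma dehomogenize_mult: "dehomogenize (f * g) = dehomogenize f * dehomogenize g"
  by (simp add: poly_eq_iff coeff_dehomogenize coeff_mult poly_sum)

lemma dehomogenize_1: "dehomogenize 1 = 1"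
  by (simp add: dehomogenize_pCons dehomogenize_0 one_pCons)

lemma dehomogenize_power: "dehomogenize (f ^ n) = dehomogenize f ^ n"
  by (induction n) (simp_all add: dehomogenize_1 dehomogenize_mult)

lemma dehomogenize_sum: "dehomogenize (sum f I) = (\<Sum>i\<in>I. dehomogenize (f i))"
  by (induction I rule: infinite_finite_induct) (auto simp: dehomogenize_add dehomogenize_0)

text \<open>By homogeneity the exponent of \<open>z\<close> determines that of \<open>y\<close>, so
  distinct monomials stay distinct at \<open>y = 1\<close>.\<close>

lemma homogeneous2_eq_0:
  fixes p :: "'f::field poly poly"
  assumes hom: "\<And>j k. coeff (coeff p j) k \<noteq> 0 \<Longrightarrow> j + k = n" and "poly p 1 = 0"
  shows "p = 0"
proof (rule ccontr)
  assume "p \<noteq> 0"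
  then obtain j k where jk: "coeff (coeff p j) k \<noteq> 0"
    by (metis leading_coeff_0_iff)
  have "j \<le> degree p" using jk by (intro le_degree) auto
  have "coeff (poly p 1) k = (\<Sum>i\<le>degree p. coeff (coeff p i) k)"
    by (simp add: poly_altdef coeff_sum)
  also have "\<dots> = (\<Sum>i\<in>{j}. coeff (coeff p i) k)"
    using hom jk \<open>j \<le> degree p\<close> by (intro sum.mono_neutral_right) (auto, metis add_right_imp_eq)
  finally show False using assms(2) jk by simp
qed

lemma conic_poly_eq: "conic_poly \<alpha> \<beta> = [:[:[:0, 0, \<beta>:], 0, [:\<alpha>:]:], [:0, 1:], 1:]"
  by (simp add: conic_poly_def power2_eq_square)

lemma homogeneous3_conic_poly: "homogeneous3 2 (conic_poly \<alpha> \<beta>)"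
  unfolding conic_poly_eq
  by (auto simp: homogeneous3_def coeff_pCons one_pCons split: nat.splits if_splits)

abbreviation conic_affine :: "'f::field \<Rightarrow> 'f \<Rightarrow> 'f poly poly" where
  "conic_affine \<alpha> \<beta> \<equiv> quadratic_poly [:\<alpha>, 0, \<beta>:]"

lemma dehomogenize_conic_poly: "dehomogenize (conic_poly \<alpha> \<beta>) = conic_affine \<alpha> \<beta>"
  by (simp add: conic_poly_eq dehomogenize_pCons dehomogenize_0 quadratic_poly_def)

text \<open>Division by the conic equation, which is monic in \<open>x\<close>; each step subtracts
  a homogeneous multiple of degree \<open>n\<close>, so the remainder stays homogeneous.\<close>

lemma homogeneous3_mod_conic:
  assumes "homogeneous3 n f"
  shows "\<exists>A B. homogeneous3 n [:A, B:] \<and> conic_poly \<alpha> \<beta> dvd f - [:A, B:]"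
  using assms
proof (induction "degree f" arbitrary: f rule: less_induct)
  case less
  show ?case
  proof (cases "degree f \<le> 1")
    case True
    then have "f = [:coeff f 0, coeff f 1:]"
      by (auto simp: poly_eq_iff coeff_pCons coeff_eq_0 split: nat.splits)
    then show ?thesis using less.prems by (metis diff_self dvd_0_right)
  next
    case False
    then obtain k where k: "degree f = k + 2"
      by (metis add.commute add_2_eq_Suc' less_2_cases_iff linorder_not_less le_Suc_ex not_less_eq_eq numeral_2_eq_2 One_nat_def)
    define g where "g = Polynomial.monom (lead_coeff f) k"
    have nz: "coeff f (k + 2) \<noteq> 0" using k by (metis add_eq_0_iff_both_eq_0 degree_0 leading_coeff_0_iff zero_neq_numeral)
    then obtain j l where "coeff (coeff (coeff f (k + 2)) j) l \<noteq> 0" by (metis leading_coeff_0_iff)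
    \<comment> \<open>A monomial of degree \<open>k + 2\<close> in \<open>x\<close> occurs, so the
      subtraction in \<open>n - 2\<close> does not truncate.\<close>
    then have n: "2 \<le> n" using less.prems by (fastforce simp: homogeneous3_def)
    have "homogeneous3 (n - 2) g"
      unfolding homogeneous3_def
    proof (intro allI impI)
      fix i j l assume "coeff (coeff (coeff g i) j) l \<noteq> 0"
      then have "i = k" "coeff (coeff (coeff f (k + 2)) j) l \<noteq> 0"
        by (auto simp: g_def k split: if_splits)
      then show "i + j + l = n - 2" using less.prems unfolding homogeneous3_def by fastforce
    qed
    then have "homogeneous3 n (g * conic_poly \<alpha> \<beta>)"
      using homogeneous3_mult[OF _ homogeneous3_conic_poly, of "n - 2" g] n
      by (metis le_add_diff_inverse2)
    from homogeneous3_add[OF less.prems homogeneous3_uminus[OF this]]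
    have hom: "homogeneous3 n (f - g * conic_poly \<alpha> \<beta>)" by simp
    have deg_q: "degree (conic_poly \<alpha> \<beta>) = 2" "coeff (conic_poly \<alpha> \<beta>) 2 = 1"
      by (simp_all add: conic_poly_eq numeral_2_eq_2)
    have "degree (g * conic_poly \<alpha> \<beta>) \<le> k + 2"
      using degree_mult_le[of g "conic_poly \<alpha> \<beta>"] degree_monom_le[of "lead_coeff f" k] deg_q
      unfolding g_def by linarith
    then have "degree (f - g * conic_poly \<alpha> \<beta>) \<le> k + 2"
      using k by (intro degree_diff_le) auto
    moreover have "coeff (f - g * conic_poly \<alpha> \<beta>) (k + 2) = 0"
      using k deg_q by (simp add: g_def coeff_monom_mult)
    ultimately have "degree (f - g * conic_poly \<alpha> \<beta>) < degree f"
      using k by (metis add_pos_pos degree_0 eq_zero_or_degree_less order_le_less trans_less_add2 zero_less_numeral)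
    from less.hyps[OF this hom] obtain A B where
      AB: "homogeneous3 n [:A, B:]" "conic_poly \<alpha> \<beta> dvd (f - g * conic_poly \<alpha> \<beta>) - [:A, B:]"
      by blast
    have "conic_poly \<alpha> \<beta> dvd ((f - g * conic_poly \<alpha> \<beta>) - [:A, B:]) + g * conic_poly \<alpha> \<beta>"
      using AB(2) by (intro dvd_add) auto
    moreover have "(f - w - z) + w = f - z" for w z by simp
    ultimately show ?thesis using AB(1) by metis
  qed
qed

text \<open>The homogeneous remainder is linear in \<open>x\<close>. If the affine equation divides
  its dehomogenization, both coefficients vanish at \<open>y = 1\<close>, hence they vanish.\<close>

lemma conic_poly_dvd_iff:
  assumes "homogeneous3 n f"
  shows "conic_poly \<alpha> \<beta> dvd f \<longleftrightarrow> conic_affine \<alpha> \<beta> dvd dehomogenize f"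
proof
  assume "conic_poly \<alpha> \<beta> dvd f"
  then show "conic_affine \<alpha> \<beta> dvd dehomogenize f"
    by (auto simp: dvd_def dehomogenize_mult dehomogenize_conic_poly)
next
  assume dvd: "conic_affine \<alpha> \<beta> dvd dehomogenize f"
  obtain A B where AB: "homogeneous3 n [:A, B:]" "conic_poly \<alpha> \<beta> dvd f - [:A, B:]"
    using homogeneous3_mod_conic[OF assms] by blast
  then have "conic_affine \<alpha> \<beta> dvd dehomogenize f - dehomogenize [:A, B:]"
    by (auto simp: dvd_def dehomogenize_mult dehomogenize_conic_poly dehomogenize_diff[symmetric])
  with dvd have "conic_affine \<alpha> \<beta> dvd dehomogenize [:A, B:]"
    by (metis diff_diff_eq2 add_diff_cancel_left' dvd_diff)
  then have "poly A 1 = 0" "poly B 1 = 0"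
    using reduces_to_dvd_iff[OF reduces_to_linear] by (auto simp: dehomogenize_pCons dehomogenize_0)
  moreover have "coeff (coeff A j) k \<noteq> 0 \<Longrightarrow> j + k = n" for j k
    using AB(1) unfolding homogeneous3_def by (metis add_0 coeff_pCons_0)
  moreover have "coeff (coeff B j) k \<noteq> 0 \<Longrightarrow> j + k = n - 1" for j k
    using AB(1) unfolding homogeneous3_def
    by (metis add.assoc add_diff_cancel_left' coeff_pCons_0 coeff_pCons_Suc One_nat_def plus_1_eq_Suc)
  ultimately have "A = 0" "B = 0" using homogeneous2_eq_0 by blast+
  then show "conic_poly \<alpha> \<beta> dvd f" using AB(2) by simp
qed

section \<open>The function field of the conic\<close>

text \<open>Values of the form with coefficients moved along \<open>h\<close>, written with type
  class sums, so that one expression serves scalars (\<open>id\<close>) and polynomials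
  (\<open>const3\<close>).\<close>

definition qf_sum :: "('a \<Rightarrow> 'r) \<Rightarrow> 'a qform \<Rightarrow> (nat \<Rightarrow> 'r) \<Rightarrow> 'r::comm_ring_1" where
  "qf_sum h \<phi> v = (\<Sum>j<qdim \<phi>. \<Sum>i\<le>j. h (qcoeff \<phi> i j) * (v i * v j))"

lemma finsum_eq_sum:
  fixes R :: "('a::comm_monoid_add, 'm) ring_scheme"
  assumes "abelian_monoid R" "add R = (+)" "zero R = 0" "f \<in> A \<rightarrow> carrier R"
  shows "finsum R f A = sum f A"
proof -
  interpret abelian_monoid R by fact
  show ?thesis
    using assms(4)
    by (induction A rule: infinite_finite_induct)
      (auto simp: finsum_infinite assms(2,3) Pi_def)
qed

lemma qf_eval_eq_qf_sum:
  fixes R :: "('a::comm_ring_1, 'm) ring_scheme"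
  assumes "ring R" "add R = (+)" "zero R = 0" "monoid.mult R = (*)"
    and "\<And>i j. i \<le> j \<Longrightarrow> j < qdim \<phi> \<Longrightarrow> qcoeff \<phi> i j \<in> carrier R"
    and "\<And>i. i < qdim \<phi> \<Longrightarrow> v i \<in> carrier R"
  shows "qf_eval R \<phi> v = qf_sum id \<phi> v"
proof -
  interpret ring R by fact
  have mem: "qcoeff \<phi> i j * (v i * v j) \<in> carrier R" if "i \<le> j" "j < qdim \<phi>" for i j
    using m_closed[OF assms(5)[OF that] m_closed[OF assms(6) assms(6)], of i j] that assms(4)
    by simp
  have inner: "(\<Oplus>\<^bsub>R\<^esub>i\<in>{..j}. qcoeff \<phi> i j * (v i * v j)) = (\<Sum>i\<le>j. qcoeff \<phi> i j * (v i * v j))"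
    if "j < qdim \<phi>" for j
    using assms(2,3) mem that by (intro finsum_eq_sum abelian_monoid_axioms) auto
  have closed: "(\<Oplus>\<^bsub>R\<^esub>i\<in>{..j}. qcoeff \<phi> i j * (v i * v j)) \<in> carrier R" if "j < qdim \<phi>" for j
    using mem that by (intro finsum_closed) auto
  have "qf_eval R \<phi> v = (\<Oplus>\<^bsub>R\<^esub>j\<in>{..<qdim \<phi>}. \<Oplus>\<^bsub>R\<^esub>i\<in>{..j}. qcoeff \<phi> i j * (v i * v j))"
    by (simp add: qf_eval_def assms(4))
  also have "\<dots> = (\<Sum>j<qdim \<phi>. \<Oplus>\<^bsub>R\<^esub>i\<in>{..j}. qcoeff \<phi> i j * (v i * v j))"
    using assms(2,3) closed by (intro finsum_eq_sum abelian_monoid_axioms) auto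
  finally show ?thesis by (simp add: inner qf_sum_def)
qed

lemma qf_eval_type: "qf_eval ring_of_type_algebra \<phi> v = qf_sum id \<phi> v"
  by (intro qf_eval_eq_qf_sum ring_from_type_algebra) (simp_all add: ring_of_type_algebra_def)

lemma (in cring) qf_eval_cong:
  assumes c: "\<And>i j. i \<le> j \<Longrightarrow> j < qdim \<phi> \<Longrightarrow> qcoeff \<phi> i j \<in> carrier R"
    and w: "\<And>i. i < qdim \<phi> \<Longrightarrow> w i \<in> carrier R"
    and eq: "\<And>i. i < qdim \<phi> \<Longrightarrow> v i = w i"
  shows "qf_eval R \<phi> v = qf_eval R \<phi> w"
  unfolding qf_eval_def
proof (rule finsum_cong'[OF refl])
  show "(\<lambda>j. \<Oplus>i\<in>{..j}. qcoeff \<phi> i j \<otimes> (w i \<otimes> w j)) \<in> {..<qdim \<phi>} \<rightarrow> carrier R"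
    using c w by (auto intro!: finsum_closed)
  fix j assume "j \<in> {..<qdim \<phi>}"
  then show "(\<Oplus>i\<in>{..j}. qcoeff \<phi> i j \<otimes> (v i \<otimes> v j)) = (\<Oplus>i\<in>{..j}. qcoeff \<phi> i j \<otimes> (w i \<otimes> w j))"
    using c w eq by (intro finsum_cong') auto
qed

lemma (in ring_hom_cring) hom_qf_eval:
  assumes "\<And>i j. i \<le> j \<Longrightarrow> j < qdim \<phi> \<Longrightarrow> qcoeff \<phi> i j \<in> carrier R"
    and "\<And>i. i < qdim \<phi> \<Longrightarrow> v i \<in> carrier R"
  shows "h (qf_eval R \<phi> v) = qf_eval S (QForm (qdim \<phi>) (\<lambda>i j. h (qcoeff \<phi> i j))) (\<lambda>i. h (v i))"
proof -
  have mem: "qcoeff \<phi> i j \<otimes> (v i \<otimes> v j) \<in> carrier R" if "i \<le> j" "j < qdim \<phi>" for i j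
    using assms that by simp
  have hom: "h (qcoeff \<phi> i j \<otimes> (v i \<otimes> v j)) = h (qcoeff \<phi> i j) \<otimes>\<^bsub>S\<^esub> (h (v i) \<otimes>\<^bsub>S\<^esub> h (v j))"
    if "i \<le> j" "j < qdim \<phi>" for i j
    using assms that by simp
  have "h (qf_eval R \<phi> v) =
      (\<Oplus>\<^bsub>S\<^esub>j\<in>{..<qdim \<phi>}. h (\<Oplus>i\<in>{..j}. qcoeff \<phi> i j \<otimes> (v i \<otimes> v j)))"
    unfolding qf_eval_def using mem by (subst hom_finsum) (auto simp: o_def intro!: R.finsum_closed)
  also have "\<dots> = (\<Oplus>\<^bsub>S\<^esub>j\<in>{..<qdim \<phi>}. \<Oplus>\<^bsub>S\<^esub>i\<in>{..j}. h (qcoeff \<phi> i j \<otimes> (v i \<otimes> v j)))"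
  proof (rule S.finsum_cong')
    fix j assume j: "j \<in> {..<qdim \<phi>}"
    then show "h (\<Oplus>i\<in>{..j}. qcoeff \<phi> i j \<otimes> (v i \<otimes> v j)) =
        (\<Oplus>\<^bsub>S\<^esub>i\<in>{..j}. h (qcoeff \<phi> i j \<otimes> (v i \<otimes> v j)))"
      using mem by (subst hom_finsum) (auto simp: o_def)
  qed (use mem in \<open>auto intro!: S.finsum_closed\<close>)
  also have "\<dots> = qf_eval S (QForm (qdim \<phi>) (\<lambda>i j. h (qcoeff \<phi> i j))) (\<lambda>i. h (v i))"
  proof -
    have "(\<Oplus>\<^bsub>S\<^esub>i\<in>{..j}. h (qcoeff \<phi> i j \<otimes> (v i \<otimes> v j))) =
        (\<Oplus>\<^bsub>S\<^esub>i\<in>{..j}. h (qcoeff \<phi> i j) \<otimes>\<^bsub>S\<^esub> (h (v i) \<otimes>\<^bsub>S\<^esub> h (v j)))" if "j < qdim \<phi>" for j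
      using that hom assms by (intro S.finsum_cong') auto
    then show ?thesis
      unfolding qf_eval_def using assms
      by (simp, intro S.finsum_cong') (auto intro!: S.finsum_closed)
  qed
  finally show ?thesis .
qed

section \<open>The local ring of the conic and its residue field\<close>

locale prime_conic =
  fixes \<alpha> \<beta> :: "'f::field"
  assumes prime: "\<And>g h. conic_affine \<alpha> \<beta> dvd g * h \<Longrightarrow> conic_affine \<alpha> \<beta> dvd g \<or> conic_affine \<alpha> \<beta> dvd h"
begin

abbreviation "q \<equiv> conic_poly \<alpha> \<beta>"
abbreviation "R \<equiv> conic_local_ring \<alpha> \<beta>"
abbreviation "I \<equiv> conic_ideal \<alpha> \<beta>"

lemma prime_conic_poly:
  assumes "homogeneous3 m f" "homogeneous3 n g" "q dvd f * g"
  shows "q dvd f \<or> q dvd g"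
  using assms(3) prime
  by (simp add: conic_poly_dvd_iff[OF assms(1)] conic_poly_dvd_iff[OF assms(2)]
      conic_poly_dvd_iff[OF homogeneous3_mult[OF assms(1,2)]] dehomogenize_mult)

lemma not_dvd_1: "\<not> q dvd 1"
proof -
  have "degree q = 2" by (simp add: conic_poly_eq)
  then show ?thesis by (metis degree_1 dvd_imp_degree_le le_zero_eq one_neq_zero zero_neq_numeral)
qed

lemma homogeneous3_1: "homogeneous3 0 1"
  using homogeneous3_const[of 1] by (simp add: one_pCons)

lemma carrier_iff:
  "u \<in> carrier R \<longleftrightarrow> (\<exists>f g n. u = Fract f g \<and> homogeneous3 n f \<and> homogeneous3 n g \<and> \<not> q dvd g)"
  by (auto simp: conic_local_ring_def)

lemma carrier_simps [simp]: "add R = (+)" "zero R = 0" "one R = 1" "monoid.mult R = (*)"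
  by (simp_all add: conic_local_ring_def)

lemma Fract_mem: "homogeneous3 n f \<Longrightarrow> homogeneous3 n g \<Longrightarrow> \<not> q dvd g \<Longrightarrow> Fract f g \<in> carrier R"
  using carrier_iff by blast

text \<open>Primality makes membership independent of the chosen fraction:
  \<open>f * g' = f' * g\<close> and \<open>q dvd f'\<close> give
  \<open>q dvd f * g'\<close>.\<close>

lemma ideal_iff:
  assumes "homogeneous3 n f" "homogeneous3 n g" "\<not> q dvd g"
  shows "Fract f g \<in> I \<longleftrightarrow> q dvd f"
proof
  assume "Fract f g \<in> I"
  then obtain f' g' m where *: "Fract f g = Fract f' g'" "homogeneous3 m f'" "homogeneous3 m g'"
      "\<not> q dvd g'" "q dvd f'"
    by (auto simp: conic_ideal_def)
  moreover have "g \<noteq> 0" "g' \<noteq> 0" using assms * by auto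
  ultimately have "f * g' = f' * g" by (simp add: eq_fract)
  then have "q dvd f * g'" using * by simp
  then show "q dvd f" using prime_conic_poly[OF assms(1) *(3)] *(4) by blast
qed (use assms in \<open>auto simp: conic_ideal_def\<close>)

text \<open>The product of the denominators works, since by primality it is not divisible by
  \<open>q\<close>.\<close>

lemma common_denominator:
  fixes m :: nat
  assumes "\<And>i. i < m \<Longrightarrow> r i \<in> carrier R"
  shows "\<exists>f g n. homogeneous3 n g \<and> \<not> q dvd g \<and> (\<forall>i<m. homogeneous3 n (f i) \<and> r i = Fract (f i) g)"
  using assms
proof (induction m)
  case 0
  then show ?case using homogeneous3_1 not_dvd_1 by blast
next
  case (Suc m)
  then obtain f g n where f: "homogeneous3 n g" "\<not> q dvd g"
      "\<And>i. i < m \<Longrightarrow> homogeneous3 n (f i) \<and> r i = Fract (f i) g"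
    by (metis less_SucI)
  obtain f' g' n' where f': "homogeneous3 n' f'" "homogeneous3 n' g'" "\<not> q dvd g'" "r m = Fract f' g'"
    using Suc.prems[of m] by (auto simp: carrier_iff)
  have nz: "g \<noteq> 0" "g' \<noteq> 0" using f f' by auto
  define F where "F i = (if i < m then f i * g' else g * f')" for i
  have "homogeneous3 (n + n') (F i) \<and> r i = Fract (F i) (g * g')" if "i < Suc m" for i
    using f f' nz that less_Suc_eq[of i m]
    by (auto simp: F_def homogeneous3_mult eq_fract algebra_simps)
  moreover have "homogeneous3 (n + n') (g * g')" "\<not> q dvd g * g'"
    using f f' homogeneous3_mult prime_conic_poly by blast+
  ultimately show ?case by blast
qed

lemma common_denominator2:
  assumes "u \<in> carrier R" "v \<in> carrier R"
  obtains f f' g n where "u = Fract f g" "v = Fract f' g"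
    "homogeneous3 n f" "homogeneous3 n f'" "homogeneous3 n g" "\<not> q dvd g" "g \<noteq> 0"
proof -
  have "(if i = 0 then u else v) \<in> carrier R" if "i < 2" for i :: nat
    using assms by simp
  from common_denominator[of 2 "\<lambda>i. if i = 0 then u else v", OF this] obtain f g n where
      "homogeneous3 n g" "\<not> q dvd g" "\<forall>i<2::nat. homogeneous3 n (f i) \<and> (if i = 0 then u else v) = Fract (f i) g"
    by blast
  then show ?thesis using that[of "f 0" g "f 1" n] by (fastforce simp: numeral_2_eq_2)
qed

lemma Fract_add: "g \<noteq> 0 \<Longrightarrow> Fract f g + Fract f' g = Fract (f + f') (g :: 'f poly3)"
  by (simp add: eq_fract algebra_simps)

lemma carrier_add:
  assumes "u \<in> carrier R" "v \<in> carrier R"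
  shows "u + v \<in> carrier R"
proof -
  from assms obtain f f' g n where *: "u = Fract f g" "v = Fract f' g"
      "homogeneous3 n f" "homogeneous3 n f'" "homogeneous3 n g" "\<not> q dvd g" "g \<noteq> 0"
    by (rule common_denominator2)
  then show ?thesis
    unfolding *(1,2) Fract_add[OF *(7)] by (intro Fract_mem homogeneous3_add)
qed

lemma carrier_mult: "u \<in> carrier R \<Longrightarrow> v \<in> carrier R \<Longrightarrow> u * v \<in> carrier R"
  by (erule (1) common_denominator2)
    (auto simp: intro!: Fract_mem homogeneous3_mult dest: prime_conic_poly)

lemma carrier_const: "Fract (const3 r) 1 \<in> carrier R"
  by (rule Fract_mem[OF homogeneous3_const homogeneous3_1 not_dvd_1])

lemma carrier_0: "0 \<in> carrier R" and carrier_1: "1 \<in> carrier R"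
  using carrier_const[of 0] carrier_const[of 1]
  by (simp_all add: Zero_fract_def One_fract_def one_pCons)

lemma carrier_uminus: "u \<in> carrier R \<Longrightarrow> - u \<in> carrier R"
  unfolding carrier_iff using homogeneous3_uminus by (metis minus_fract)

lemma cring_R: "cring R"
proof (rule cringI)
  show "abelian_group R"
    by (rule abelian_groupI)
      (auto simp: carrier_add carrier_0 add_ac intro: bexI[OF _ carrier_uminus])
  show "comm_monoid R"
    by (rule comm_monoidI) (auto simp: carrier_mult carrier_1 mult_ac)
qed (auto simp: algebra_simps)

lemma ideal_I: "ideal I R"
proof (rule idealI)
  interpret cring R by (rule cring_R)
  show "ring R" by (rule ring_axioms)
  have sub: "I \<subseteq> carrier R"
    by (auto simp: conic_ideal_def intro: Fract_mem)
  have absorb: "u * v \<in> I" if "u \<in> I" "v \<in> carrier R" for u v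
  proof -
    have "u \<in> carrier R" using that sub by blast
    from this that(2) obtain f f' g n where *: "u = Fract f g" "v = Fract f' g"
        "homogeneous3 n f" "homogeneous3 n f'" "homogeneous3 n g" "\<not> q dvd g" "g \<noteq> 0"
      by (rule common_denominator2)
    then have "q dvd f" using ideal_iff that(1) by blast
    moreover have "\<not> q dvd g * g" using * prime_conic_poly by blast
    ultimately show ?thesis
      using * ideal_iff[OF homogeneous3_mult homogeneous3_mult, of n f n f' g g] by simp
  qed
  have add: "u + v \<in> I" if "u \<in> I" "v \<in> I" for u v
  proof -
    have "u \<in> carrier R" "v \<in> carrier R" using that sub by blast+
    then obtain f f' g n where *: "u = Fract f g" "v = Fract f' g"
        "homogeneous3 n f" "homogeneous3 n f'" "homogeneous3 n g" "\<not> q dvd g" "g \<noteq> 0"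
      by (rule common_denominator2)
    then have "q dvd f" "q dvd f'" using ideal_iff that by blast+
    then show ?thesis
      unfolding *(1,2) Fract_add[OF *(7)] using * ideal_iff[OF homogeneous3_add, of n f f' g] by simp
  qed
  have zero: "0 \<in> I"
    using ideal_iff[OF homogeneous3_0 homogeneous3_1 not_dvd_1] by (simp add: Zero_fract_def)
  have "\<ominus>\<^bsub>R\<^esub> u = - u" if "u \<in> carrier R" for u
    using that minus_equality[of "- u" u] carrier_uminus by simp
  moreover have "- u \<in> I" if "u \<in> I" for u
    using absorb[OF that carrier_uminus[OF carrier_1]] by simp
  ultimately show "subgroup I (add_monoid R)"
    using add zero sub by (intro add.subgroupI) (auto simp flip: a_inv_def)
  show "v \<otimes>\<^bsub>R\<^esub> u \<in> I" "u \<otimes>\<^bsub>R\<^esub> v \<in> I" if "u \<in> I" "v \<in> carrier R" for u v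
    using absorb[OF that] by (simp_all add: mult.commute)
qed

sublocale conic: ideal I R by (rule ideal_I)

sublocale quot: ring_hom_cring R "R Quot I" "(+>\<^bsub>R\<^esub>) I"
  by (rule conic.rcos_ring_hom_cring[OF cring_R])

lemma coset_eq_zero_iff: "u \<in> carrier R \<Longrightarrow> I +>\<^bsub>R\<^esub> u = \<zero>\<^bsub>R Quot I\<^esub> \<longleftrightarrow> u \<in> I"
  using conic.a_rcos_const conic.rcos_const_imp_mem by (auto simp: FactRing_def)

text \<open>A quadratic form turns the common denominator \<open>g\<close> into
  \<open>g * g\<close>, so only the numerator decides whether the value vanishes.\<close>

lemma qf_eval_coset:
  assumes hom: "\<And>i. i < qdim \<phi> \<Longrightarrow> homogeneous3 n (f i)" "homogeneous3 n g" "\<not> q dvd g"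
    and v: "\<And>i. i < qdim \<phi> \<Longrightarrow> v i = I +>\<^bsub>R\<^esub> Fract (f i) g"
  shows "qf_eval (R Quot I) (base_change (conic_embed \<alpha> \<beta>) \<phi>) v = \<zero>\<^bsub>R Quot I\<^esub> \<longleftrightarrow>
    q dvd qf_sum (\<lambda>r. const3 r) \<phi> f"
proof -
  let ?\<psi> = "QForm (qdim \<phi>) (\<lambda>i j. Fract (const3 (qcoeff \<phi> i j)) 1)"
  have g: "g \<noteq> 0" using hom by auto
  have mem: "Fract (f i) g \<in> carrier R" if "i < qdim \<phi>" for i
    using hom that by (intro Fract_mem)
  have "qf_eval (R Quot I) (base_change (conic_embed \<alpha> \<beta>) \<phi>) v =
      qf_eval (R Quot I) (base_change (conic_embed \<alpha> \<beta>) \<phi>) (\<lambda>i. I +>\<^bsub>R\<^esub> Fract (f i) g)"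
    using v mem carrier_const quot.hom_closed
    by (intro quot.S.qf_eval_cong) (auto simp: base_change_def conic_embed_def)
  also have "\<dots> = I +>\<^bsub>R\<^esub> qf_eval R ?\<psi> (\<lambda>i. Fract (f i) g)"
    using quot.hom_qf_eval[of ?\<psi> "\<lambda>i. Fract (f i) g"] mem carrier_const
    by (simp add: base_change_def conic_embed_def)
  also have "qf_eval R ?\<psi> (\<lambda>i. Fract (f i) g) = qf_sum id ?\<psi> (\<lambda>i. Fract (f i) g)"
    using mem carrier_const conic.ring_axioms by (intro qf_eval_eq_qf_sum) auto
  also have "\<dots> = Fract (qf_sum (\<lambda>r. const3 r) \<phi> f) (g * g)"
    using g by (simp add: qf_sum_def Fract_conv_to_fract sum_divide_distrib del: mult_pCons_left)
  also have "I +>\<^bsub>R\<^esub> \<dots> = \<zero>\<^bsub>R Quot I\<^esub> \<longleftrightarrow> q dvd qf_sum (\<lambda>r. const3 r) \<phi> f"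
  proof -
    have "homogeneous3 (0 + (n + n)) (qf_sum (\<lambda>r. const3 r) \<phi> f)"
      unfolding qf_sum_def using hom
      by (intro homogeneous3_sum homogeneous3_mult homogeneous3_const) auto
    moreover have "homogeneous3 (n + n) (g * g)" "\<not> q dvd g * g"
      using hom homogeneous3_mult prime_conic_poly by blast+
    ultimately show ?thesis using coset_eq_zero_iff Fract_mem ideal_iff by simp
  qed
  finally show ?thesis .
qed

text \<open>One direction clears denominators. The other divides by a power of \<open>var_y\<close>,
  which becomes 1 in the chart and so is not divisible by \<open>q\<close>.\<close>

lemma isotropic_over_FQ_iff:
  "isotropic_over_FQ (quaternion_algebra \<alpha> \<beta>) \<phi> \<longleftrightarrow>
    (\<exists>n f. (\<forall>i<qdim \<phi>. homogeneous3 n (f i)) \<and> (\<exists>i<qdim \<phi>. \<not> q dvd f i) \<and>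
      q dvd qf_sum (\<lambda>r. const3 r) \<phi> f)"
proof -
  have FQ: "quat_function_field (quaternion_algebra \<alpha> \<beta>) = R Quot I"
    "quat_function_field_embed (quaternion_algebra \<alpha> \<beta>) = conic_embed \<alpha> \<beta>"
    by (simp_all add: quat_function_field_def quat_function_field_embed_def conic_function_field_def)
  have dim: "qdim (base_change h \<phi>) = qdim \<phi>" for h :: "'f \<Rightarrow> 'b" by (simp add: base_change_def)
  show ?thesis
    unfolding isotropic_over_FQ_def isotropic_def FQ dim
  proof (rule iffI; elim exE bexE conjE)
    fix v i
    assume v: "v \<in> {..<qdim \<phi>} \<rightarrow> carrier (R Quot I)"
      and i: "i < qdim \<phi>" "v i \<noteq> \<zero>\<^bsub>R Quot I\<^esub>"
      and eval: "qf_eval (R Quot I) (base_change (conic_embed \<alpha> \<beta>) \<phi>) v = \<zero>\<^bsub>R Quot I\<^esub>"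
    have "\<exists>r\<in>carrier R. v i = I +>\<^bsub>R\<^esub> r" if "i < qdim \<phi>" for i
      using v that by (auto simp: FactRing_def A_RCOSETS_def' Pi_def)
    then obtain r where r: "\<And>i. i < qdim \<phi> \<Longrightarrow> r i \<in> carrier R \<and> v i = I +>\<^bsub>R\<^esub> r i"
      by metis
    then obtain f g n where f: "homogeneous3 n g" "\<not> q dvd g"
        "\<forall>i<qdim \<phi>. homogeneous3 n (f i) \<and> r i = Fract (f i) g"
      using common_denominator[of "qdim \<phi>" r] by blast
    have "q dvd qf_sum (\<lambda>r. const3 r) \<phi> f"
      using qf_eval_coset[of \<phi> n f g v] f r eval by simp
    moreover have "\<not> q dvd f i"
      using i f r[OF i(1)] coset_eq_zero_iff ideal_iff by metis
    ultimately show "\<exists>n f. (\<forall>i<qdim \<phi>. homogeneous3 n (f i)) \<and> (\<exists>i<qdim \<phi>. \<not> q dvd f i) \<and>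
        q dvd qf_sum (\<lambda>r. const3 r) \<phi> f"
      using f i(1) by blast
  next
    fix n f i
    assume f: "\<forall>i<qdim \<phi>. homogeneous3 n (f i)" and i: "i < qdim \<phi>" "\<not> q dvd f i"
      and dvd: "q dvd qf_sum (\<lambda>r. const3 r) \<phi> f"
    define g :: "'f poly3" where "g = var_y ^ n"
    have hg: "homogeneous3 n g"
      using homogeneous3_power[OF homogeneous3_var(2), of n] by (simp add: g_def)
    have "dehomogenize g = 1"
      by (simp add: g_def dehomogenize_power dehomogenize_pCons dehomogenize_0 pCons_one)
    then have g: "\<not> q dvd g"
      using conic_poly_dvd_iff[OF hg] conic_poly_dvd_iff[OF homogeneous3_1] not_dvd_1
      by (metis dehomogenize_1)
    let ?v = "\<lambda>i. I +>\<^bsub>R\<^esub> Fract (f i) g"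
    have mem: "Fract (f i) g \<in> carrier R" if "i < qdim \<phi>" for i
      using f hg g that Fract_mem by blast
    have "qf_eval (R Quot I) (base_change (conic_embed \<alpha> \<beta>) \<phi>) ?v = \<zero>\<^bsub>R Quot I\<^esub>"
      using qf_eval_coset[of \<phi> n f g ?v] f hg g dvd by simp
    moreover have "?v i \<noteq> \<zero>\<^bsub>R Quot I\<^esub>"
      using i f hg g mem coset_eq_zero_iff ideal_iff by metis
    ultimately show "\<exists>v\<in>{..<qdim \<phi>} \<rightarrow> carrier (R Quot I). (\<exists>i<qdim \<phi>. v i \<noteq> \<zero>\<^bsub>R Quot I\<^esub>) \<and>
        qf_eval (R Quot I) (base_change (conic_embed \<alpha> \<beta>) \<phi>) v = \<zero>\<^bsub>R Quot I\<^esub>"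
      using mem i(1) by (intro bexI[of _ ?v]) auto
  qed
qed

end

section \<open>Subforms\<close>

definition qf_polar :: "('a \<Rightarrow> 'r) \<Rightarrow> 'a qform \<Rightarrow> (nat \<Rightarrow> 'r) \<Rightarrow> (nat \<Rightarrow> 'r) \<Rightarrow> 'r::comm_ring_1" where
  "qf_polar h \<phi> u v = (\<Sum>j<qdim \<phi>. \<Sum>i\<le>j. h (qcoeff \<phi> i j) * (u i * v j + v i * u j))"

lemma qf_sum_add: "qf_sum h \<phi> (\<lambda>k. u k + v k) = qf_sum h \<phi> u + qf_sum h \<phi> v + qf_polar h \<phi> u v"
  by (simp add: qf_sum_def qf_polar_def algebra_simps sum.distrib)

lemma qf_sum_scale: "qf_sum h \<phi> (\<lambda>k. s * u k) = s * s * qf_sum h \<phi> u"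
  by (simp add: qf_sum_def sum_distrib_left mult_ac)

lemma qf_polar_add: "qf_polar h \<phi> (\<lambda>k. u k + u' k) v = qf_polar h \<phi> u v + qf_polar h \<phi> u' v"
  by (simp add: qf_polar_def algebra_simps sum.distrib)

lemma qf_polar_scale: "qf_polar h \<phi> (\<lambda>k. s * u k) (\<lambda>k. s' * v k) = s * s' * qf_polar h \<phi> u v"
  by (simp add: qf_polar_def sum_distrib_left algebra_simps)

lemma qf_polar_combination:
  "qf_polar h \<phi> (\<lambda>k. \<Sum>i<r. f i * u i k) (\<lambda>k. s * v k) = (\<Sum>i<(r::nat). f i * s * qf_polar h \<phi> (u i) v)"
proof (induction r)
  case 0
  then show ?case by (simp add: qf_polar_def)
qed (simp add: qf_polar_add qf_polar_scale)

lemma qf_sum_combination: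
  "qf_sum h \<phi> (\<lambda>k. \<Sum>i<r. f i * u i k) =
    (\<Sum>j<(r::nat). f j * f j * qf_sum h \<phi> (u j) + (\<Sum>i<j. f i * f j * qf_polar h \<phi> (u i) (u j)))"
proof (induction r)
  case 0
  then show ?case by (simp add: qf_sum_def)
qed (simp add: qf_sum_add qf_sum_scale qf_polar_combination)

lemma sum_atMost_split: "(\<Sum>i\<le>j. g i) = g j + (\<Sum>i<(j::nat). g i :: 'a::comm_monoid_add)"
  by (metis add.commute lessThan_Suc_atMost sum.lessThan_Suc)

text \<open>The relation of a subform concerns values over the ground field only. Evaluation at unit
  vectors and at their sums recovers the coefficients of \<open>\<psi>\<close>, and the resulting
  coefficient identities persist under \<open>h\<close>.\<close>

lemma subform_qf_sum:
  fixes h :: "'f::field \<Rightarrow> 'r::comm_ring_1"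
  assumes h: "h 0 = 0" "\<And>x y. h (x + y) = h x + h y" "\<And>x y. h (x * y) = h x * h y"
    and w: "\<And>t. qf_sum id \<psi> t = qf_sum id \<phi> (\<lambda>k. \<Sum>i<qdim \<psi>. t i * w i k)"
  shows "qf_sum h \<psi> f = qf_sum h \<phi> (\<lambda>k. \<Sum>i<qdim \<psi>. f i * h (w i k))"
proof -
  let ?r = "qdim \<psi>"
  have h_sum: "h (sum g A) = (\<Sum>i\<in>A. h (g i))" for g :: "nat \<Rightarrow> 'f" and A
    by (induction A rule: infinite_finite_induct) (auto simp: h)
  have unit: "(\<Sum>i<?r. (if i = p then 1 else 0) * w i k) = w p k" if "p < ?r" for p k
  proof -
    have "(\<Sum>i<?r. (if i = p then 1 else 0) * w i k) = (\<Sum>i<?r. if i = p then w i k else 0)"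
      by (rule sum.cong) auto
    then show ?thesis using that by simp
  qed
  have diag: "qcoeff \<psi> p p = qf_sum id \<phi> (w p)" if "p < ?r" for p
  proof -
    let ?e = "\<lambda>i. if i = p then 1 else 0 :: 'f"
    have "qf_sum id \<psi> ?e = (\<Sum>j<?r. if j = p then (\<Sum>i\<le>j. if i = p then qcoeff \<psi> i j else 0) else 0)"
      unfolding qf_sum_def by (rule sum.cong) (auto simp: mult_delta_right)
    also have "\<dots> = qcoeff \<psi> p p" using that by simp
    finally show ?thesis using w[of ?e] that by (simp add: unit)
  qed
  have off: "qcoeff \<psi> p s = qf_polar id \<phi> (w p) (w s)" if "p < s" "s < ?r" for p s
  proof -
    let ?e = "\<lambda>p i. if i = p then 1 else 0 :: 'f"
    have "qf_polar id \<psi> (?e p) (?e s) =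
        (\<Sum>j<?r. if j = s then (\<Sum>i\<le>j. if i = p then qcoeff \<psi> i j else 0) else 0)"
      unfolding qf_polar_def using that(1)
      by (intro sum.cong) (auto simp: mult_delta_right intro!: sum.neutral)
    also have "\<dots> = qcoeff \<psi> p s" using that by simp
    finally have "qcoeff \<psi> p s = qf_sum id \<psi> (\<lambda>k. ?e p k + ?e s k) - qf_sum id \<psi> (?e p) - qf_sum id \<psi> (?e s)"
      by (simp add: qf_sum_add)
    also have "\<dots> = qf_sum id \<phi> (\<lambda>k. w p k + w s k) - qf_sum id \<phi> (w p) - qf_sum id \<phi> (w s)"
      unfolding w using that by (simp only: unit distrib_right sum.distrib less_trans[OF that])
    also have "\<dots> = qf_polar id \<phi> (w p) (w s)"
      by (simp add: qf_sum_add)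
    finally show ?thesis .
  qed
  have "qf_sum h \<phi> (\<lambda>k. h (w p k)) = h (qcoeff \<psi> p p)" if "p < ?r" for p
    using that by (simp add: diag qf_sum_def h h_sum)
  moreover have "qf_polar h \<phi> (\<lambda>k. h (w p k)) (\<lambda>k. h (w s k)) = h (qcoeff \<psi> p s)" if "p < s" "s < ?r" for p s
    using that by (simp add: off qf_polar_def h h_sum)
  ultimately show ?thesis
    unfolding qf_sum_combination unfolding qf_sum_def sum_atMost_split by (simp add: mult_ac)
qed

text \<open>Induction on the number of equations: a solution \<open>l\<close> with
  \<open>l k \<noteq> 0\<close> and a nonzero solution \<open>m\<close> supported away from
  \<open>k\<close> are independent, and one of their combinations also satisfies the last
  equation.\<close>

lemma underdetermined_system:
  fixes w :: "nat \<Rightarrow> nat \<Rightarrow> 'f::field"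
  assumes "finite K" "r < card K"
  shows "\<exists>l. (\<exists>k\<in>K. l k \<noteq> 0) \<and> (\<forall>k. k \<notin> K \<longrightarrow> l k = 0) \<and> (\<forall>i<r. (\<Sum>k\<in>K. l k * w i k) = 0)"
  using assms
proof (induction r arbitrary: K)
  case 0
  then obtain k where "k \<in> K" by fastforce
  then show ?case by (intro exI[of _ "\<lambda>i. if i = k then 1 else 0"]) auto
next
  case (Suc r)
  obtain l k where l: "k \<in> K" "l k \<noteq> 0" "\<And>k. k \<notin> K \<Longrightarrow> l k = 0" "\<And>i. i < r \<Longrightarrow> (\<Sum>k\<in>K. l k * w i k) = 0"
    using Suc.IH[of K] Suc.prems by auto
  have "r < card (K - {k})" using Suc.prems l(1) by simp
  then obtain m where m: "\<exists>k\<in>K - {k}. m k \<noteq> 0" "\<And>j. j \<notin> K - {k} \<Longrightarrow> m j = 0"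
      "\<And>i. i < r \<Longrightarrow> (\<Sum>k\<in>K - {k}. m k * w i k) = 0"
    using Suc.IH[of "K - {k}"] Suc.prems by auto
  have mK: "(\<Sum>k\<in>K. m k * w i k) = 0" if "i < r" for i
    using m(2)[of k] m(3)[OF that] Suc.prems(1) l(1) by (simp add: sum.remove[of K k])
  define s where "s = (\<Sum>k\<in>K. m k * w r k)"
  define u where "u = (\<Sum>k\<in>K. l k * w r k)"
  show ?case
  proof (cases "s = 0")
    case True
    then show ?thesis using m(1,2) mK by (intro exI[of _ m]) (auto simp: s_def less_Suc_eq)
  next
    case False
    let ?n = "\<lambda>j. s * l j - u * m j"
    have "(\<Sum>k\<in>K. ?n k * w i k) = s * (\<Sum>k\<in>K. l k * w i k) - u * (\<Sum>k\<in>K. m k * w i k)" for i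
      by (simp add: sum_distrib_left sum_subtractf left_diff_distrib mult.assoc)
    then have n1: "\<forall>i<Suc r. (\<Sum>k\<in>K. ?n k * w i k) = 0"
      using l(4) mK by (auto simp: less_Suc_eq s_def u_def)
    have n2: "\<exists>k\<in>K. ?n k \<noteq> 0" using False l(1,2) m(2)[of k] by (intro bexI[of _ k]) auto
    have n3: "\<forall>j. j \<notin> K \<longrightarrow> ?n j = 0" using l(3) m(2) by simp
    show ?thesis by (rule exI[of _ ?n], intro conjI, fact n2, fact n3, fact n1)
  qed
qed

section \<open>The form over a field with suitable degree function\<close>

text \<open>The explicit isotropic vector on the chart \<open>y = 1\<close>, homogenized to degree 3
  in \<open>x\<close>, \<open>y\<close>, \<open>z\<close>; its value splits off the conic
  equation.\<close>

lemma isotropic_vector_identity: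
  fixes x y z a b c d :: "'r::comm_ring_1"
  assumes "(2 :: 'r) = 0"
  shows "d * ((d * (x * (z * z)))\<^sup>2 + d * (x * (z * z)) * (d * (y * (z * z))) + (a + c) * (d * (y * (z * z)))\<^sup>2) +
      c * ((d * (x * (y * z)))\<^sup>2 + d * (x * (y * z)) * (d * (y * (y * z))) + (a + b) * (d * (y * (y * z)))\<^sup>2) +
      b * c * d * ((x * (y * y))\<^sup>2 + x * (y * y) * (y * (y * y)) + a * (y * (y * y))\<^sup>2) + (d * d * (z * (z * z)))\<^sup>2 =
    (x\<^sup>2 + x * y + a * y\<^sup>2 + d * z\<^sup>2) * (d ^ 3 * z ^ 4 + c * d\<^sup>2 * y\<^sup>2 * z\<^sup>2 + b * c * d * y ^ 4)"
  by (simp add: eval_nat_numeral algebra_simps char_2_double[OF assms])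

text \<open>The value \<open>2 * W 3\<close> of \<open>b\<close> allows \<open>z\<close> to have
  degree \<open>W 3 + 1\<close>: then \<open>d * z\<^sup>2\<close> has degree
  \<open>2 * W 3 + W 1 + 2\<close>, between those of \<open>b\<close> and \<open>b * c\<close>. The
  summand 1 is invisible to the ground field, whose degrees have constant coefficient 0.\<close>

locale minimal_form = degree_function "{0}" v
  for v :: "'f::field \<Rightarrow> int poly" +
  fixes a b c d :: 'f
  assumes two: "(2::'f) = 0"
    and nz: "a \<noteq> 0" "b \<noteq> 0" "c \<noteq> 0" "d \<noteq> 0"
    and v_gens: "v a = W 4" "v b = 2 * W 3" "v c = W 2" "v d = W 1"
    and v_class: "\<And>z. z \<noteq> 0 \<Longrightarrow> coeff (v z) 0 = 0 \<and> even (coeff (v z) 3)"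
begin

definition form :: "'f qform" where
  "form = scale_qf d (binary_qf (a + c)) \<perp> scale_qf c (binary_qf (a + b)) \<perp>
            scale_qf (b * c * d) (binary_qf a) \<perp> unary_qf 1"

lemma qdim_form: "qdim form = 7"
  by (simp add: form_def orth_sum_def scale_qf_def binary_qf_def unary_qf_def Let_def)

lemma qf_sum_form:
  fixes h :: "'f \<Rightarrow> 'r::comm_ring_1"
  assumes h: "h 0 = 0" "h 1 = 1" "\<And>x y. h (x + y) = h x + h y" "\<And>x y. h (x * y) = h x * h y"
  shows "qf_sum h form f =
    h d * ((f 0)\<^sup>2 + f 0 * f 1 + (h a + h c) * (f 1)\<^sup>2) + h c * ((f 2)\<^sup>2 + f 2 * f 3 + (h a + h b) * (f 3)\<^sup>2) +
      h b * h c * h d * ((f 4)\<^sup>2 + f 4 * f 5 + h a * (f 5)\<^sup>2) + (f 6)\<^sup>2"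
  unfolding qf_sum_def qdim_form
  by (simp add: form_def orth_sum_def scale_qf_def binary_qf_def unary_qf_def Let_def h
      eval_nat_numeral atMost_Suc power2_eq_square algebra_simps)

section \<open>The degree function on the function field of the conic\<close>

abbreviation "gauss \<equiv> gauss_degree v (W 3 + 1)"
abbreviation "e \<equiv> [:a, 0, d:]"
abbreviation "Z \<equiv> {g. conic_affine a d dvd g}"
abbreviation "v\<^sub>Q \<equiv> quadratic_degree gauss e"

text \<open>The exponent \<open>k\<close> of the affine variable adds \<open>k\<close> to both
  coefficients, while a ground field element adds 0 to the first and an even number to the
  second.\<close>

lemma gauss_class:
  assumes "p \<noteq> 0"
  obtains k m where "coeff (gauss p) 0 = k" "coeff (gauss p) 3 = k + 2 * m"
proof -
  obtain k where "coeff p k \<noteq> 0" "gauss p = v (coeff p k) + of_nat k * (W 3 + 1)"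
    using gauss_degree_attained[OF assms] by metis
  moreover obtain m where "coeff (v (coeff p k)) 3 = 2 * m"
    using v_class[OF calculation(1)] by blast
  ultimately show ?thesis
    using v_class[of "coeff p k"] that[of "int k" m] by (simp add: of_nat_poly coeff_W)
qed

lemma gauss_var: "gauss [:0, 1:] = W 3 + 1"
  using gauss_degree_var[of v "W 3 + 1"] v_one by simp

lemma gauss_const: "r \<noteq> 0 \<Longrightarrow> gauss [:r:] = v r"
  by (rule gauss_degree_const)

sublocale g: degree_function "{0}" gauss
  by (rule degree_function_gauss[OF degree_function_axioms])

lemma gauss_e: "e \<noteq> 0" "gauss e = W 4"
proof -
  have e_eq: "e = [:a:] + [:d:] * [:0, 1:]\<^sup>2" by (simp add: power2_eq_square)
  have "gauss ([:d:] * [:0, 1:]\<^sup>2) = W 1 + 2 * (W 3 + 1)"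
    using nz gauss_var v_gens g.v_mult[of "[:d:]" "[:0, 1:]\<^sup>2"] g.v_power2[of "[:0, 1:]"] gauss_const[of d]
    by (simp del: mult_pCons_left)
  then have "[:d:] * [:0, 1:]\<^sup>2 \<in> g.below (gauss [:a:])"
    using nz v_gens gauss_const[of a] W_less by (simp add: g.below_def del: mult_pCons_left)
  then show "e \<noteq> 0" "gauss e = W 4"
    using g.v_add_below[of "[:a:]"] nz gauss_const[of a] v_gens unfolding e_eq
    by (simp_all del: mult_pCons_left)
qed

text \<open>Coefficient 4 decides: it is even in doubled degrees and equals 1 in
  \<open>gauss e\<close>.\<close>

lemma ramified: "ramified_quadratic gauss e"
proof
  show "e \<noteq> 0" "0 < gauss e" using gauss_e W_less by simp_all
  fix A B :: "'f poly"
  show "2 * gauss A \<noteq> gauss e + 2 * gauss B"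
  proof
    assume "2 * gauss A = gauss e + 2 * gauss B"
    then have "coeff (2 * gauss A) 4 = coeff (W 4 + 2 * gauss B) 4" using gauss_e by simp
    then have "2 * coeff (gauss A) 4 = 1 + 2 * coeff (gauss B) 4" by (simp add: coeff_W_simps)
    then show False by presburger
  qed
qed

sublocale Q: ramified_quadratic gauss e by (rule ramified)

text \<open>The support of a degree function is a prime ideal, which gives primality of the conic
  equation.\<close>

sublocale FQ: prime_conic a d
proof -
  interpret q: degree_function Z "v\<^sub>Q" by (rule Q.degree_function_quadratic)
  show "prime_conic a d" by unfold_locales (use q.mult_notmem in blast)
qed

lemma vQ_const: "A \<noteq> 0 \<Longrightarrow> [:A:] \<notin> Z \<and> v\<^sub>Q [:A:] = 2 * gauss A"
  using reduces_to_dvd_iff[OF reduces_to_linear[of e A 0]]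
    quadratic_degree_eq[OF reduces_to_linear[of e A 0], of gauss] g.v_mult[of A A]
  by (simp add: norm_form_def)

lemma conic_degree: "conic_degree Z v\<^sub>Q [:[:a:]:] [:[:b:]:] [:[:c:]:] [:[:d:]:] [:0, 1:] [:[:0, 1:]:]"
proof -
  interpret q: degree_function Z "v\<^sub>Q" by (rule Q.degree_function_quadratic)
  have x: "[:0, 1:] \<notin> Z \<and> v\<^sub>Q [:0, 1:] = W 4"
    using reduces_to_dvd_iff[OF reduces_to_linear[of e 0 1]]
      quadratic_degree_eq[OF reduces_to_linear[of e 0 1], of gauss] gauss_e
    by (simp add: norm_form_def)
  show ?thesis
  proof
    show "(2 :: 'f poly poly) = 0" using two by (simp add: numeral_poly)
    show "[:0, 1:]\<^sup>2 + [:0, 1:] + [:[:a:]:] + [:[:d:]:] * [:[:0, 1:]:]\<^sup>2 \<in> Z"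
      by (simp add: quadratic_poly_def power2_eq_square)
    show "[:[:b:]:] \<notin> Z" "[:[:c:]:] \<notin> Z" "[:[:d:]:] \<notin> Z" "[:0, 1:] \<notin> Z" "[:[:0, 1:]:] \<notin> Z"
      using vQ_const[of "[:b:]"] vQ_const[of "[:c:]"] vQ_const[of "[:d:]"] vQ_const[of "[:0, 1:]"] x nz
      by simp_all
    show "v\<^sub>Q [:[:b:]:] = 4 * W 3" "v\<^sub>Q [:[:c:]:] = 2 * W 2" "v\<^sub>Q [:[:d:]:] = 2 * W 1"
      using vQ_const[of "[:b:]"] vQ_const[of "[:c:]"] vQ_const[of "[:d:]"] nz v_gens gauss_const by simp_all
    show "v\<^sub>Q [:0, 1:] = W 4" using x by simp
    show "v\<^sub>Q [:[:0, 1:]:] = 2 * W 3 + 2"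
      using vQ_const[of "[:0, 1:]"] gauss_var by simp
    fix g assume "g \<notin> Z"
    obtain A B where AB: "reduces_to e g A B" using reduces_to_ex by blast
    then have "A \<noteq> 0 \<or> B \<noteq> 0" using \<open>g \<notin> Z\<close> reduces_to_dvd_iff by blast
    \<comment> \<open>The possible summand \<open>W 4\<close> does not affect coefficients 0 to 3,
      so doubling \<open>gauss_class\<close> gives divisibility by 4.\<close>
    from Q.v_norm_form(4)[OF this] obtain C :: "'f poly" where
        C: "C \<noteq> 0" "v\<^sub>Q g = 2 * gauss C \<or> v\<^sub>Q g = W 4 + 2 * gauss C"
      unfolding quadratic_degree_eq[OF AB, of gauss] gauss_e by blast
    obtain k m where "coeff (gauss C) 0 = k" "coeff (gauss C) 3 = k + 2 * m"
      using gauss_class[OF C(1)] by blast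
    then show "even (coeff (v\<^sub>Q g) 1) \<and> even (coeff (v\<^sub>Q g) 2) \<and> 4 dvd coeff (v\<^sub>Q g) 3 - coeff (v\<^sub>Q g) 0"
      using C(2) by (auto simp: coeff_W_simps)
  qed
qed

sublocale C: conic_degree Z "v\<^sub>Q" "[:[:a:]:]" "[:[:b:]:]" "[:[:c:]:]" "[:[:d:]:]" "[:0, 1:]" "[:[:0, 1:]:]"
  by (rule conic_degree)

lemma const3_hom:
  "const3 0 = (0 :: 'f poly3)" "const3 1 = (1 :: 'f poly3)"
  "const3 (r + s) = (const3 r + const3 s :: 'f poly3)" "const3 (r * s) = (const3 r * const3 s :: 'f poly3)"
  by (simp_all add: pCons_one)

lemma const3_sum: "const3 (sum g K) = (\<Sum>i\<in>K. const3 (g i) :: 'f poly3)"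
  by (induction K rule: infinite_finite_induct) (simp_all add: const3_hom(3) del: add_pCons)

lemma dehomogenize_const3: "dehomogenize (const3 r) = [:[:r:]:]"
  by (simp add: dehomogenize_pCons dehomogenize_0)

lemma dvd_dehomogenize: "FQ.q dvd f \<Longrightarrow> dehomogenize f \<in> Z"
  by (auto simp: dvd_def dehomogenize_mult dehomogenize_conic_poly)

text \<open>Isotropy and the linear relation pass to the chart \<open>y = 1\<close>. There nonzero
  constants have doubled ground field degrees, with coefficient 0 equal to 0 and coefficient 4 even,
  so \<open>coordinates_independent\<close> applies.\<close>

lemma isotropic_vector_independent:
  assumes hom: "\<And>i. i < 7 \<Longrightarrow> homogeneous3 n (f i)" and nonzero: "\<exists>i<7. \<not> FQ.q dvd f i"
    and iso: "FQ.q dvd qf_sum (\<lambda>r. const3 r) form f"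
    and sum: "(\<Sum>i<7. const3 (l i) * f i) = 0"
  shows "\<forall>i<7. l i = 0"
proof -
  let ?F = "\<lambda>i. dehomogenize (f i)" and ?l = "\<lambda>i. [:[:l i:]:]"
  have "dehomogenize (qf_sum (\<lambda>r. const3 r) form f) \<in> Z"
    by (rule dvd_dehomogenize[OF iso])
  then have F: "[:[:d:]:] * ((?F 0)\<^sup>2 + ?F 0 * ?F 1 + ([:[:a:]:] + [:[:c:]:]) * (?F 1)\<^sup>2) +
      [:[:c:]:] * ((?F 2)\<^sup>2 + ?F 2 * ?F 3 + ([:[:a:]:] + [:[:b:]:]) * (?F 3)\<^sup>2) +
      [:[:b:]:] * [:[:c:]:] * [:[:d:]:] * ((?F 4)\<^sup>2 + ?F 4 * ?F 5 + [:[:a:]:] * (?F 5)\<^sup>2) + (?F 6)\<^sup>2 \<in> Z"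
    using qf_sum_form[of "\<lambda>r. const3 r" f, OF const3_hom]
    by (simp only: dehomogenize_add dehomogenize_mult dehomogenize_power dehomogenize_const3)
  have ex: "\<exists>i<7. ?F i \<notin> Z"
    using nonzero hom conic_poly_dvd_iff by blast
  have l: "coeff (v\<^sub>Q (?l i)) 0 = 0 \<and> even (coeff (v\<^sub>Q (?l i)) 4)" if "?l i \<notin> Z" for i
  proof -
    have "l i \<noteq> 0" using that by auto
    then show ?thesis using vQ_const[of "[:l i:]"] gauss_const[of "l i"] v_class[of "l i"]
      by (simp add: coeff_W_simps)
  qed
  have sumZ: "(\<Sum>i<7. ?l i * ?F i) \<in> Z"
  proof -
    have "(\<Sum>i<7. ?l i * ?F i) = dehomogenize (\<Sum>i<7. const3 (l i) * f i)"
      by (simp only: dehomogenize_sum dehomogenize_mult dehomogenize_const3)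
    then show ?thesis by (simp only: sum dehomogenize_0) simp
  qed
  have "\<forall>i<7. ?l i \<in> Z"
    by (rule C.coordinates_independent[OF F ex l sumZ])
  moreover have "l i = 0" if "?l i \<in> Z" for i
    using vQ_const[of "[:l i:]"] that unfolding pCons_eq_0_iff by blast
  ultimately show ?thesis by blast
qed

section \<open>The three conditions of minimality\<close>

lemma isotropic_form: "isotropic_over_FQ (quaternion_algebra a d) form"
proof -
  define x y z :: "'f poly3" where "x = var_x" and "y = var_y" and "z = var_z"
  define A B C D :: "'f poly3" where "A = const3 a" and "B = const3 b" and "C = const3 c" and "D = const3 d"
  define f where "f i = [D * (x * (z * z)), D * (y * (z * z)), D * (x * (y * z)), D * (y * (y * z)),
      x * (y * y), y * (y * y), D * D * (z * (z * z))] ! i" for i :: nat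
  have less7: "j = 0 \<or> j = 1 \<or> j = 2 \<or> j = 3 \<or> j = 4 \<or> j = 5 \<or> j = 6" if "j < 7" for j :: nat
    using that by linarith
  have hD: "homogeneous3 3 (D * g)" if "homogeneous3 3 g" for g
    using homogeneous3_mult[OF homogeneous3_const that, of d] by (simp add: D_def)
  have h3: "homogeneous3 3 (g * (h * k))" if "homogeneous3 1 g" "homogeneous3 1 h" "homogeneous3 1 k" for g h k
    using homogeneous3_mult[OF that(1) homogeneous3_mult[OF that(2,3)]] by (simp add: numeral_3_eq_3)
  have "homogeneous3 1 x" "homogeneous3 1 y" "homogeneous3 1 z"
    by (simp_all only: x_def y_def z_def homogeneous3_var)
  then have "homogeneous3 3 (f i)" if "i < 7" for i
    using less7[OF that]
    by (elim disjE) (simp_all add: f_def hD h3 mult.assoc)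
  moreover have "\<not> FQ.q dvd f 5"
  proof
    assume "FQ.q dvd f 5"
    then have "dehomogenize (f 5) \<in> Z" by (rule dvd_dehomogenize)
    moreover have "dehomogenize (f 5) = 1"
      by (simp add: f_def y_def dehomogenize_mult dehomogenize_pCons dehomogenize_0 pCons_one)
    ultimately show False using C.one_notmem by simp
  qed
  moreover have "FQ.q dvd qf_sum (\<lambda>r. const3 r) form f"
  proof -
    have two': "(2 :: 'f poly3) = 0" using two by (simp add: numeral_poly)
    have "qf_sum (\<lambda>r. const3 r) form f =
        (x\<^sup>2 + x * y + A * y\<^sup>2 + D * z\<^sup>2) * (D ^ 3 * z ^ 4 + C * D\<^sup>2 * y\<^sup>2 * z\<^sup>2 + B * C * D * y ^ 4)"
      unfolding qf_sum_form[of "\<lambda>r. const3 r" f, OF const3_hom, folded A_def B_def C_def D_def]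
      unfolding isotropic_vector_identity[OF two', symmetric]
      by (simp add: f_def)
    then show ?thesis by (simp add: conic_poly_def x_def y_def z_def A_def D_def)
  qed
  ultimately show ?thesis
    unfolding FQ.isotropic_over_FQ_iff qdim_form by (intro exI[of _ 3] exI[of _ f]) (auto intro: exI[of _ 5])
qed

text \<open>Seven coordinates in the ground field satisfy a nontrivial linear relation over it,
  which isotropic vectors never do.\<close>

lemma anisotropic_form: "anisotropic form"
proof -
  have False if v: "i < 7" "u i \<noteq> 0" "qf_sum id form u = 0" for u :: "nat \<Rightarrow> 'f" and i
  proof -
    obtain l where l: "\<exists>k\<in>{..<7}. l k \<noteq> 0" "(\<Sum>k<7. l k * u k) = 0"
      using underdetermined_system[of "{..<7}" 1 "\<lambda>_. u"] by auto
    let ?f = "\<lambda>i. const3 (u i)"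
    have "qf_sum (\<lambda>r. const3 r) form ?f = const3 (qf_sum id form u)"
      unfolding qf_sum_def const3_sum const3_hom by simp
    then have "FQ.q dvd qf_sum (\<lambda>r. const3 r) form ?f" using v(3) by simp
    moreover have "\<not> FQ.q dvd ?f i"
    proof
      assume "FQ.q dvd ?f i"
      then have "dehomogenize (?f i) \<in> Z" by (rule dvd_dehomogenize)
      then show False using vQ_const[of "[:u i:]"] v(2) by (simp add: dehomogenize_const3)
    qed
    moreover have "(\<Sum>i<7. const3 (l i) * ?f i) = 0"
      using l(2) const3_sum[of "\<lambda>k. l k * u k" "{..<7}"] by (simp only: const3_hom)
    ultimately have "\<forall>i<7. l i = 0"
      using isotropic_vector_independent[OF homogeneous3_const] v(1) by blast
    then show False using l(1) by auto
  qed
  then show ?thesis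
    by (auto simp: anisotropic_def isotropic_def qf_eval_type qdim_form)
      (auto simp: ring_of_type_algebra_def)
qed

text \<open>A proper subspace lies in the kernel of a nonzero linear functional \<open>l\<close>
  over the ground field. An isotropic vector of the subform would yield one of the whole form whose
  coordinates satisfy the relation \<open>l\<close>.\<close>

lemma not_isotropic_strict_subform:
  assumes "strict_subform \<psi> form"
  shows "\<not> isotropic_over_FQ (quaternion_algebra a d) \<psi>"
proof
  assume "isotropic_over_FQ (quaternion_algebra a d) \<psi>"
  then obtain n f i where f: "\<And>i. i < qdim \<psi> \<Longrightarrow> homogeneous3 n (f i)" "i < qdim \<psi>" "\<not> FQ.q dvd f i"
      "FQ.q dvd qf_sum (\<lambda>r. const3 r) \<psi> f"
    unfolding FQ.isotropic_over_FQ_iff by blast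
  obtain w where inj: "\<And>t. (\<And>k. k < 7 \<Longrightarrow> (\<Sum>i<qdim \<psi>. t i * w i k) = 0) \<Longrightarrow> \<forall>i<qdim \<psi>. t i = 0"
    and w: "\<And>t. qf_sum id \<psi> t = qf_sum id form (\<lambda>k. \<Sum>i<qdim \<psi>. t i * w i k)"
    and dim: "qdim \<psi> < 7"
    using assms unfolding strict_subform_def subform_def qf_eval_type qdim_form by blast
  obtain l where l: "\<exists>k\<in>{..<7}. l k \<noteq> 0" "\<And>i. i < qdim \<psi> \<Longrightarrow> (\<Sum>k<7. l k * w i k) = 0"
    using underdetermined_system[of "{..<7}" "qdim \<psi>" w] dim by auto
  define g where "g k = (\<Sum>i<qdim \<psi>. f i * const3 (w i k))" for k
  have "homogeneous3 n (g k)" for k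
    unfolding g_def using f(1) homogeneous3_mult[OF _ homogeneous3_const] by (fastforce intro: homogeneous3_sum)
  \<comment> \<open>The basis \<open>w\<close> stays independent over the function field: if all
    \<open>g k\<close> vanish there, their linear remainders vanish, and comparing coefficients
    gives linear relations over the ground field.\<close>
  moreover have "\<exists>k<7. \<not> FQ.q dvd g k"
  proof (rule ccontr)
    assume "\<not> ?thesis"
    then have gZ: "dehomogenize (g k) \<in> Z" if "k < 7" for k
      using that dvd_dehomogenize by blast
    have "\<exists>p. reduces_to e (dehomogenize (f i)) (fst p) (snd p)" for i
      using reduces_to_ex[of e "dehomogenize (f i)"] by auto
    then obtain P where P: "\<And>i. reduces_to e (dehomogenize (f i)) (fst (P i)) (snd (P i))"
      by metis
    define A B where "A i = fst (P i)" and "B i = snd (P i)" for i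
    have AB: "reduces_to e (dehomogenize (f i)) (A i) (B i)" for i
      using P by (simp add: A_def B_def)
    have "reduces_to e (\<Sum>i<m. dehomogenize (f i) * [:[:w i k:]:]) (\<Sum>i<m. A i * [:w i k:]) (\<Sum>i<m. B i * [:w i k:])"
      for k and m :: nat
    proof (induction m)
      case 0
      show ?case using reduces_to_linear[of e 0 0] by simp
    next
      case (Suc m)
      then show ?case
        using reduces_to_add[OF Suc reduces_to_mult[OF AB[of m] reduces_to_linear[of e "[:w m k:]" 0]]]
        by simp
    qed
    moreover have "(\<Sum>i<m. dehomogenize (f i) * [:[:w i k:]:]) = dehomogenize (\<Sum>i<m. f i * const3 (w i k))"
      for k and m :: nat
      by (simp only: dehomogenize_sum dehomogenize_mult dehomogenize_const3)
    ultimately have "reduces_to e (dehomogenize (g k)) (\<Sum>i<qdim \<psi>. A i * [:w i k:]) (\<Sum>i<qdim \<psi>. B i * [:w i k:])" for k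
      by (simp add: g_def)
    then have zero: "(\<Sum>i<qdim \<psi>. A i * [:w i k:]) = 0" "(\<Sum>i<qdim \<psi>. B i * [:w i k:]) = 0" if "k < 7" for k
      using gZ[OF that] reduces_to_dvd_iff by blast+
    have coeff: "coeff (\<Sum>i<qdim \<psi>. P i * [:w i k:]) m = (\<Sum>i<qdim \<psi>. coeff (P i) m * w i k)" for P k m
      by (simp add: coeff_sum mult.commute)
    have "coeff (A i) m = 0 \<and> coeff (B i) m = 0" for m
      using inj[of "\<lambda>i. coeff (A i) m"] inj[of "\<lambda>i. coeff (B i) m"] f(2) zero
      unfolding coeff[symmetric] by simp
    then have "A i = 0" "B i = 0" by (simp_all add: poly_eq_iff)
    then show False
      using AB[of i] reduces_to_dvd_iff f(1,2,3) conic_poly_dvd_iff by blast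
  qed
  moreover have "FQ.q dvd qf_sum (\<lambda>r. const3 r) form g"
    unfolding g_def subform_qf_sum[OF const3_hom(1,3,4) w, of f, symmetric] by (rule f(4))
  moreover have "(\<Sum>k<7. const3 (l k) * g k) = 0"
  proof -
    have "(\<Sum>k<7. const3 (l k) * g k) = (\<Sum>k<7. \<Sum>i<qdim \<psi>. f i * const3 (l k * w i k))"
      unfolding g_def sum_distrib_left const3_hom by (simp only: mult_ac)
    also have "\<dots> = (\<Sum>i<qdim \<psi>. f i * const3 (\<Sum>k<7. l k * w i k))"
      unfolding const3_sum sum_distrib_left by (rule sum.swap)
    also have "\<dots> = 0" using l(2) by simp
    finally show ?thesis .
  qed
  ultimately have "\<forall>k<7. l k = 0" by (rule isotropic_vector_independent)
  then show False using l(1) by auto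
qed

lemma FQ_minimal_form: "FQ_minimal (quaternion_algebra a d) form"
  using anisotropic_form isotropic_form not_isotropic_strict_subform by (auto simp: FQ_minimal_def)

end

section \<open>Iterated Laurent series\<close>

lemma coeff_fls_degree:
  "coeff (fls_degree v g f) n = coeff (v (fls_nth f (fls_subdegree f))) n - fls_subdegree f * coeff g n"
  by (simp add: fls_degree_def of_int_poly)

lemma less_W:
  assumes "\<And>n. k \<le> n \<Longrightarrow> coeff p n = 0"
  shows "p < W k"
proof -
  have "coeff (W k - p) k = 1" using assms by (simp add: coeff_W)
  moreover have "degree (W k - p) \<le> k" using assms by (intro degree_le) (auto simp: coeff_W)
  ultimately have "degree (W k - p) = k" by (metis antisym le_degree zero_neq_one)
  then show ?thesis using \<open>coeff (W k - p) k = 1\<close> by (simp add: less_poly_def pos_poly_def)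
qed

text \<open>Degrees of coefficients involve only \<open>W j\<close> with \<open>j < k\<close>, so a
  \<open>g\<close> at least \<open>W k\<close> is infinitely large for them. The second conclusion
  provides the same hypothesis for the next layer of series.\<close>

lemma degree_function_fls_W:
  fixes v :: "'a::idom \<Rightarrow> int poly"
  assumes "degree_function {0} v" and "\<And>x n. x \<noteq> 0 \<Longrightarrow> k \<le> n \<Longrightarrow> coeff (v x) n = 0"
    and "W k \<le> g" "\<And>n. k < n \<Longrightarrow> coeff g n = 0"
  shows "degree_function {0} (fls_degree v g)"
    and "x \<noteq> 0 \<Longrightarrow> Suc k \<le> n \<Longrightarrow> coeff (fls_degree v g x) n = 0"
proof -
  show "degree_function {0} (fls_degree v g)"
    using assms(1)
  proof (rule degree_function_fls)
    fix x y :: 'a assume "x \<noteq> 0" "y \<noteq> 0"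
    then have "v x - v y < W k" using assms(2) by (intro less_W) simp
    then show "v x - v y < g" using assms(3) by (rule less_le_trans)
  qed
  show "coeff (fls_degree v g x) n = 0" if "x \<noteq> 0" "Suc k \<le> n"
    using that assms(2,4) by (simp add: coeff_fls_degree)
qed

lemma fls_two: "(2 :: 'a::comm_ring_1) = 0 \<Longrightarrow> (2 :: 'a fls) = 0"
  by (metis fls_const_0 fls_const_1 fls_plus_const one_add_one)

theorem proposition4p6:
  fixes a b c d :: "'k::field fls fls fls fls"
  assumes "CHAR('k) = 2"
    and "inverse a = fls_X"
    and "inverse b = fls_const fls_X"
    and "inverse c = fls_const (fls_const fls_X)"
    and "inverse d = fls_const (fls_const (fls_const fls_X))"
  shows "FQ_minimal (quaternion_algebra a d)
           (scale_qf d (binary_qf (a + c)) \<perp> scale_qf c (binary_qf (a + b)) \<perp>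
            scale_qf (b * c * d) (binary_qf a) \<perp> unary_qf 1)"
proof -
  \<comment> \<open>The constants get the trivial degree; the layers then follow the nesting of the
    series, with the variable of \<open>d\<close> innermost and that of \<open>a\<close>
    outermost.\<close>
  define v0 :: "'k \<Rightarrow> int poly" where "v0 = (\<lambda>_. 0)"
  define v1 where "v1 = fls_degree v0 (W 1)"
  define v2 where "v2 = fls_degree v1 (W 2)"
  \<comment> \<open>The factor 2 makes coefficient 3 even on the ground field, as required by
    \<open>v_class\<close>.\<close>
  define v3 where "v3 = fls_degree v2 (2 * W 3)"
  define v where "v = fls_degree v3 (W 4)"
  have v0: "degree_function {0} v0" by (rule degree_function_zeroI) (simp_all add: v0_def)
  have v1: "degree_function {0} v1" "\<And>x n. x \<noteq> 0 \<Longrightarrow> 2 \<le> n \<Longrightarrow> coeff (v1 x) n = 0"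
    using degree_function_fls_W[OF v0, of 1 "W 1"] by (simp_all add: v0_def v1_def coeff_W)
  have v2: "degree_function {0} v2" "\<And>x n. x \<noteq> 0 \<Longrightarrow> 3 \<le> n \<Longrightarrow> coeff (v2 x) n = 0"
    using degree_function_fls_W[OF v1, where g = "W 2"] by (simp_all add: v2_def coeff_W)
  have v3: "degree_function {0} v3" "\<And>x n. x \<noteq> 0 \<Longrightarrow> 4 \<le> n \<Longrightarrow> coeff (v3 x) n = 0"
    using degree_function_fls_W[OF v2, where g = "2 * W 3"] W_less
    by (simp_all add: v3_def coeff_W_simps)
  have v: "degree_function {0} v"
    using degree_function_fls_W(1)[OF v3, where g = "W 4"] by (simp add: v_def coeff_W)
  interpret degree_function "{0}" v by (rule v)
  have gens: "a = fls_X_inv" "b = fls_const fls_X_inv" "c = fls_const (fls_const fls_X_inv)"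
      "d = fls_const (fls_const (fls_const fls_X_inv))"
    using assms(2-5)[THEN arg_cong[of _ _ inverse]]
    by (simp_all add: fls_inverse_const fls_inverse_X)
  have one: "v0 1 = 0" "v1 1 = 0" "v2 1 = 0" "v3 1 = 0"
    by (simp_all add: v0_def v1_def v2_def v3_def fls_degree_def)
  have "(2::'k) = 0" using of_nat_CHAR[where ?'a = 'k] assms(1) by simp
  then have two: "(2 :: 'k fls fls fls fls) = 0" by (intro fls_two)
  have "minimal_form v a b c d"
  proof
    show "v a = W 4" "v b = 2 * W 3" "v c = W 2" "v d = W 1"
      using one unfolding gens
      by (simp_all add: v_def v3_def v2_def v1_def fls_degree_fls_const fls_degree_X_inv)
    show "coeff (v z) 0 = 0 \<and> even (coeff (v z) 3)" if "z \<noteq> 0" for z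
      by (simp add: v_def v3_def v2_def v1_def v0_def coeff_fls_degree coeff_W_simps)
  qed (use two in \<open>simp_all add: gens\<close>)
  then show ?thesis
    using minimal_form.FQ_minimal_form minimal_form.form_def by metis
qed

end
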